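(* Let $n\ge 2$. There exists a constant $c_n$ depending only on $n$ such that the following holds. Let $\alpha\in(0,1)$, and suppose that $\Omega$ is homogeneous of degree zero on $\mathbb{R}^n\setminus\{0\}$, has zero average on $\mathbb{S}^{n-1}$, and belongs to $L^{\frac{n}{\alpha},\infty}(\mathbb{S}^{n-1})$. Then for every $f\in C_c^\infty(\mathbb{R}^n)$ and every $x\in\mathbb{R}^n$, $$T^\star_\Omega f(x)\le c_n\,(1-\alpha)\,\|\Omega\|_{L^{\frac{n}{\alpha},\infty}(\mathbb{S}^{n-1})}\,I_\alpha(\mathcal{D}^\alpha f)(x).$$
   Context: The maximal truncated rough singular integral is $$T^\star_\Omega f(x)=\sup_{t>0}\left|\int_{|y|>t}\frac{\Omega(y)}{|y|^n}f(x-y)\,dy\right|.$$ The Riesz potential is $I_\alpha g(x)=\int_{\mathbb{R}^n}\frac{g(y)}{|x-y|^{n-\alpha}}\,dy$ for $0<\alpha<n$ (no normalizing constant). The nonlinear fractional differential operator is, for $0<\alpha<1$, $$\mathcal{D}^\alpha f(x)=\int_{\mathbb{R}^n}\frac{|f(x)-f(y)|}{|x-y|^{n+\alpha}}\,dy.$$ Homogeneous of degree zero means $\Omega(\lambda y)=\Omega(y)$ for all $\lambda>0$, $y\neq0$; zero average means $\int_{\mathbb{S}^{n-1}}\Omega\,d\sigma=0$, where $\sigma$ is surface measure on the unit sphere $\mathbb{S}^{n-1}$. For $0<p<\infty$, $\|\Omega\|_{L^{p,\infty}(\mathbb{S}^{n-1})}=\sup_{t>0}t\,\sigma(\{\theta\in\mathbb{S}^{n-1}:|\Omega(\theta)|>t\})^{1/p}$,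 and $L^{p,\infty}(\mathbb{S}^{n-1})$ is the set of functions for which this is finite. *)

theory Defs
  imports "HOL-Analysis.Analysis"
begin

text \<open>
  Functions are complex-valued, which includes the real-valued case. Quantities that are
  suprema or integrals of nonnegative functions take values in \<^typ>\<open>ennreal\<close>, so that no
  finiteness is presupposed.
\<close>

section \<open>Surface measure on the unit sphere\<close>

text \<open>
  The surface measure of \<open>A\<close> is \<open>n\<close> times the Lebesgue measure of the cone
  \<open>{r \<theta> | 0 < r < 1, \<theta> \<in> A}\<close>, i.e. the measure of the polar coordinates formula. It is
  completed, so that functions on the sphere need only be measurable up to null sets.
\<close>

definition sphere_measure :: "'a::euclidean_space measure" where
  "sphere_measure =
     completion (scale_measure (of_nat DIM('a))
       (distr (restrict_space lborel (ball 0 1 - {0})) (restrict_space borel (sphere 0 1)) sgn))"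

lemma space_sphere_measure [simp]:
  "space (sphere_measure :: 'a::euclidean_space measure) = sphere 0 1"
  by (simp add: sphere_measure_def space_scale_measure space_restrict_space)

lemma emeasure_sphere_measure:
  fixes A :: "'a::euclidean_space set"
  assumes "A \<in> sets borel" "A \<subseteq> sphere 0 1"
  shows "emeasure sphere_measure A =
           of_nat DIM('a) * emeasure lborel {y \<in> ball 0 1 - {0}. sgn y \<in> A}"
proof -
  have sgn: "sgn \<in> measurable (restrict_space lborel (ball 0 1 - {0}))
                      (restrict_space borel (sphere (0::'a) 1))"
  proof (rule measurable_restrict_space2)
    show "sgn \<in> space (restrict_space lborel (ball 0 1 - {0})) \<rightarrow> sphere (0::'a) 1"
      by (auto simp: space_restrict_space norm_sgn)
    have "sgn \<in> borel_measurable (borel :: 'a measure)"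
      unfolding sgn_div_norm by measurable
    then show "sgn \<in> borel_measurable (restrict_space lborel (ball (0::'a) 1 - {0}))"
      by (intro measurable_restrict_space1) simp
  qed
  have A: "A \<in> sets (restrict_space borel (sphere 0 1))"
    using assms by (auto simp: sets_restrict_space)
  have eq: "sgn -` A \<inter> space (restrict_space lborel (ball 0 1 - {0})) =
            {y \<in> ball 0 1 - {0}. sgn y \<in> A}"
    by (auto simp: space_restrict_space)
  show ?thesis
    unfolding sphere_measure_def using A
    by (simp add: emeasure_distr[OF sgn A] eq emeasure_restrict_space del: vimage_Int)
       (auto intro!: arg_cong[where f = "\<lambda>B. of_nat DIM('a) * emeasure lborel B"])
qed

section \<open>Kernels\<close>

definition homogeneous_degree_zero :: "('a::real_normed_vector \<Rightarrow> 'b) \<Rightarrow> bool" where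
  "homogeneous_degree_zero \<Omega> \<longleftrightarrow> (\<forall>r>0. \<forall>y. y \<noteq> 0 \<longrightarrow> \<Omega> (r *\<^sub>R y) = \<Omega> y)"

text \<open>
  Used only for members of \<open>L\<^bsup>p,\<infinity>\<^esup>\<close> with \<open>p > 1\<close>, which are integrable because the
  surface measure is finite.
\<close>

definition zero_average :: "('a::euclidean_space \<Rightarrow> complex) \<Rightarrow> bool" where
  "zero_average \<Omega> \<longleftrightarrow> (LINT \<theta>|sphere_measure. \<Omega> \<theta>) = 0"

definition weak_Lp_norm :: "real \<Rightarrow> ('a::euclidean_space \<Rightarrow> complex) \<Rightarrow> ennreal" where
  "weak_Lp_norm p \<Omega> =
     (SUP t\<in>{0<..}. ennreal (t * measure sphere_measure {\<theta> \<in> sphere 0 1. t < norm (\<Omega> \<theta>)} powr (1 / p)))"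

definition weak_Lp :: "real \<Rightarrow> ('a::euclidean_space \<Rightarrow> complex) set" where
  "weak_Lp p = {\<Omega>. \<Omega> \<in> borel_measurable sphere_measure \<and> weak_Lp_norm p \<Omega> < \<infinity>}"

section \<open>Test functions\<close>

fun Ck :: "nat \<Rightarrow> ('a::real_normed_vector \<Rightarrow> 'b::real_normed_vector) \<Rightarrow> bool" where
  "Ck 0 f \<longleftrightarrow> continuous_on UNIV f"
| "Ck (Suc k) f \<longleftrightarrow>
     (\<forall>x. f differentiable (at x)) \<and> (\<forall>v. Ck k (\<lambda>x. frechet_derivative f (at x) v))"

definition Cc_infinity :: "('a::real_normed_vector \<Rightarrow> 'b::real_normed_vector) set" where
  "Cc_infinity = {f. (\<forall>k. Ck k f) \<and> compact (closure {x. f x \<noteq> 0})}"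

section \<open>Operators\<close>

definition truncated_integral ::
  "('a::euclidean_space \<Rightarrow> complex) \<Rightarrow> ('a \<Rightarrow> complex) \<Rightarrow> real \<Rightarrow> 'a \<Rightarrow> complex" where
  "truncated_integral \<Omega> f t x =
     (LINT y:{y. t < norm y}|lebesgue. \<Omega> y / of_real (norm y ^ DIM('a)) * f (x - y))"

definition maximal_truncated ::
  "('a::euclidean_space \<Rightarrow> complex) \<Rightarrow> ('a \<Rightarrow> complex) \<Rightarrow> 'a \<Rightarrow> ennreal" where
  "maximal_truncated \<Omega> f x = (SUP t\<in>{0<..}. ennreal (norm (truncated_integral \<Omega> f t x)))"

text \<open>In the next two integrands the value at \<open>y = x\<close> is irrelevant, as \<open>{x}\<close> is a null set.\<close>

definition riesz_potential :: "real \<Rightarrow> ('a::euclidean_space \<Rightarrow> ennreal) \<Rightarrow> 'a \<Rightarrow> ennreal" where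
  "riesz_potential \<alpha> g x =
     (\<integral>\<^sup>+ y. g y / ennreal (norm (x - y) powr (real DIM('a) - \<alpha>)) \<partial>lebesgue)"

definition nonlinear_derivative ::
  "real \<Rightarrow> ('a::euclidean_space \<Rightarrow> complex) \<Rightarrow> 'a \<Rightarrow> ennreal" where
  "nonlinear_derivative \<alpha> f x =
     (\<integral>\<^sup>+ y. ennreal (norm (f x - f y) / norm (x - y) powr (real DIM('a) + \<alpha>)) \<partial>lebesgue)"

end

theory Submission
  imports Defs
begin

text \<open>
  Write \<open>n\<close> for the dimension, \<open>B\<^sub>\<rho>\<close> for the ball of radius \<open>\<rho>\<close> around \<open>0\<close>, and
  \<open>N\<close> for the weak norm of \<open>\<Omega>\<close>; by a reflection and a translation let \<open>x = 0\<close>. The kernel is spread over balls by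
  \<open>|y|\<^sup>-\<^sup>n = n \<integral> \<rho>\<^sup>-\<^sup>n\<^sup>-\<^sup>1 d\<rho>\<close>, the integral being over \<open>\<rho> > |y|\<close>. So the truncated integral is an average over
  \<open>\<rho>\<close> of integrals of \<open>\<Omega> f\<close> over the shells \<open>t < |y| < \<rho>\<close>, and it is enough to bound each of these by
  a dimensional constant times \<open>N (1 - \<alpha>) \<rho>\<^sup>\<alpha>\<close> times the Gagliardo energy of \<open>f\<close> on the convex set \<open>B\<^sub>\<rho>\<close>: the energy is at most the
  integral of the nonlinear derivative over \<open>B\<^sub>\<rho>\<close>, and integrating
  \<open>n \<rho>\<^sup>\<alpha>\<^sup>-\<^sup>n\<^sup>-\<^sup>1\<close> over \<open>\<rho> > |y|\<close> gives \<open>n / (n - \<alpha>) \<le> 2\<close> times the Riesz kernel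
  (\<open>truncated_kernel_integral_le\<close>).

  Both sides of the shell estimate decompose over the superlevel sets of \<open>f\<close>, once \<open>f\<close> is split into its
  real and imaginary parts; for the energy this is the
  coarea formula \<open>gagliardo_coarea\<close>. Hence \<open>f\<close> may be the indicator of a set \<open>E\<close>. As \<open>\<Omega>\<close> has mean zero on the
  shell, \<open>E\<close> may be replaced by its complement in \<open>B\<^sub>\<rho>\<close>, so that it fills at most half of the ball. The
  weak-type bound gives \<open>\<integral>\<^sub>E |\<Omega>| \<le> 2 N \<rho>\<^sup>\<alpha> |E|\<^bsup>1 - \<alpha>/n\<^esup>\<close>, with a constant that is uniform in \<open>\<alpha>\<close> because
  \<open>n / \<alpha> \<ge> 2\<close>, and what remains is the relative fractional isoperimetric inequality
  \<open>|E|\<^bsup>1 - \<alpha>/n\<^esup> \<le> c (1 - \<alpha>) \<cdot> energy\<close> (\<open>relative_fractional_isoperimetric\<close>).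

  The factor \<open>1 - \<alpha>\<close> has a single source. Passing from \<open>x\<close> to \<open>y\<close> through the midpoint shows that the part of
  the energy with \<open>|x - y| < R\<close> is at most \<open>2\<^bsup>1 - \<alpha>\<^esup>\<close> times the part with \<open>|x - y| < R / 2\<close>. The energy on
  distances between \<open>R / 8\<close> and \<open>R\<close> is therefore at most the fraction \<open>1 - 2\<^bsup>-3(1 - \<alpha>)\<^esup> \<le> 3 (1 - \<alpha>)\<close> of the whole
  (\<open>gagliardo_shell_le\<close>). For \<open>R\<close> comparable to \<open>|E|\<^bsup>1/n\<^esup>\<close> the pairs of points at these
  distances with one point in \<open>E\<close> and one outside already have measure at least \<open>|E|\<^sup>2 / 2\<close>.
\<close>

section \<open>Changes of variables and of the order of integration\<close>

lemma nn_integral_lborel_affine: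
  fixes f :: "'a::euclidean_space \<Rightarrow> ennreal"
  assumes [measurable]: "f \<in> borel_measurable borel" and c: "c \<noteq> 0"
  shows "(\<integral>\<^sup>+x. f x \<partial>lborel) = ennreal (\<bar>c\<bar> ^ DIM('a)) * (\<integral>\<^sup>+x. f (t + c *\<^sub>R x) \<partial>lborel)"
  by (subst lborel_affine[OF c, of t])
     (simp add: nn_integral_density nn_integral_distr nn_integral_cmult ennreal_power)

lemma lborel_integral_affine:
  fixes f :: "'a::euclidean_space \<Rightarrow> 'b::{banach, second_countable_topology}"
  assumes [measurable]: "f \<in> borel_measurable borel" and c: "c \<noteq> 0"
  shows "(LINT x|lborel. f x) = (\<bar>c\<bar> ^ DIM('a)) *\<^sub>R (LINT x|lborel. f (t + c *\<^sub>R x))"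
  by (subst lborel_affine[OF c, of t])
     (simp add: integral_density integral_distr)

lemma (in pair_sigma_finite) norm_iterated_integral_le:
  fixes h :: "'a \<Rightarrow> 'b \<Rightarrow> 'c::{banach, second_countable_topology}"
  assumes h: "integrable (M1 \<Otimes>\<^sub>M M2) (\<lambda>(x, y). h x y)"
  shows "ennreal (norm (LINT x|M1. LINT y|M2. h x y)) \<le> (\<integral>\<^sup>+y. ennreal (norm (LINT x|M1. h x y)) \<partial>M2)"
proof -
  have "(LINT x|M1. LINT y|M2. h x y) = (LINT y|M2. LINT x|M1. h x y)"
    using Fubini_integral[OF h] by simp
  moreover have "integrable M2 (\<lambda>y. LINT x|M1. h x y)"
    using integrable_snd[OF h] by simp
  ultimately show ?thesis
    by (simp add: integral_norm_bound_ennreal)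
qed

section \<open>The Gagliardo energy at comparable distances\<close>

text \<open>
  The range of distances is half-open, so that adjacent ranges add up exactly to the energy on their union.
\<close>

definition gagliardo_between ::
  "real \<Rightarrow> real \<Rightarrow> real \<Rightarrow> 'a::euclidean_space set \<Rightarrow> ('a \<Rightarrow> 'b::euclidean_space) \<Rightarrow> ennreal" where
  "gagliardo_between r R \<alpha> B f =
     (\<integral>\<^sup>+x. \<integral>\<^sup>+y. ennreal (norm (f x - f y) / norm (x - y) powr (real DIM('a) + \<alpha>)) *
        indicator B x * indicator B y * indicator {r..<R} (norm (x - y)) \<partial>lborel \<partial>lborel)"

definition gagliardo :: "real \<Rightarrow> 'a::euclidean_space set \<Rightarrow> ('a \<Rightarrow> 'b::euclidean_space) \<Rightarrow> ennreal" where
  "gagliardo \<alpha> B f =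
     (\<integral>\<^sup>+x. \<integral>\<^sup>+y. ennreal (norm (f x - f y) / norm (x - y) powr (real DIM('a) + \<alpha>)) *
        indicator B x * indicator B y \<partial>lborel \<partial>lborel)"

lemma gagliardo_between_le: "gagliardo_between r R \<alpha> B f \<le> gagliardo \<alpha> B f"
  unfolding gagliardo_between_def gagliardo_def
  by (intro nn_integral_mono) (auto split: split_indicator)

lemma gagliardo_between_split:
  assumes [measurable]: "f \<in> borel_measurable borel" "B \<in> sets borel" and "q \<le> r" "r \<le> R"
  shows "gagliardo_between q R \<alpha> B f = gagliardo_between q r \<alpha> B f + gagliardo_between r R \<alpha> B f"
proof -
  have "gagliardo_between q r \<alpha> B f + gagliardo_between r R \<alpha> B f =
    (\<integral>\<^sup>+x. \<integral>\<^sup>+y. (ennreal (norm (f x - f y) / norm (x - y) powr (real DIM('a) + \<alpha>)) *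
        indicator B x * indicator B y * indicator {q..<r} (norm (x - y)) +
      ennreal (norm (f x - f y) / norm (x - y) powr (real DIM('a) + \<alpha>)) *
        indicator B x * indicator B y * indicator {r..<R} (norm (x - y))) \<partial>lborel \<partial>lborel)"
    unfolding gagliardo_between_def
    by (subst nn_integral_add[symmetric]) (auto intro!: nn_integral_cong nn_integral_add[symmetric])
  also have "\<dots> = gagliardo_between q R \<alpha> B f"
    unfolding gagliardo_between_def
    using assms(3,4) by (intro nn_integral_cong) (auto split: split_indicator)
  finally show ?thesis by simp
qed

text \<open>
  In \<open>|f x - f y| \<le> |f x - f m| + |f m - f y|\<close> with \<open>m\<close> the midpoint, both terms contribute equally by
  symmetry. For fixed \<open>x\<close>, replacing \<open>y\<close> by \<open>m\<close> halves the distance: the Jacobian is \<open>2\<^sup>n\<close> and the kernel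
  gives \<open>2\<^bsup>-(n + \<alpha>)\<^esup>\<close>. Convexity keeps \<open>m\<close> inside \<open>B\<close>.
\<close>

lemma gagliardo_between_halve:
  fixes B :: "'a::euclidean_space set"
  assumes [measurable]: "f \<in> borel_measurable borel" "B \<in> sets borel"
    and B: "convex B"
  shows "gagliardo_between 0 R \<alpha> B f \<le> ennreal (2 powr (1 - \<alpha>)) * gagliardo_between 0 (R / 2) \<alpha> B f"
proof -
  define k where "k x y = norm (x - y) powr (real DIM('a) + \<alpha>)" for x y :: 'a
  define m where "m x y = (1/2) *\<^sub>R x + (1/2) *\<^sub>R y" for x y :: 'a
  define I where "I x y = (indicator B x * indicator B y * indicator {0..<R} (norm (x - y)) :: ennreal)" for x y
  define g where "g x y = ennreal (norm (f x - f (m x y)) / k x y) * I x y" for x y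
  have [measurable]: "(\<lambda>(x, y). k x y) \<in> borel_measurable (borel \<Otimes>\<^sub>M borel)"
      "(\<lambda>(x, y). m x y) \<in> borel_measurable (borel \<Otimes>\<^sub>M borel)"
      "(\<lambda>(x, y). I x y) \<in> borel_measurable (borel \<Otimes>\<^sub>M borel)"
    unfolding k_def m_def I_def by (simp_all add: split_beta')
  have [measurable]: "(\<lambda>(x, y). g x y) \<in> borel_measurable (borel \<Otimes>\<^sub>M borel)"
    unfolding g_def by (simp add: split_beta')
  have sym: "m x y = m y x" "k x y = k y x" "I x y = I y x" for x y
    by (auto simp: m_def k_def I_def norm_minus_commute add.commute split: split_indicator)
  have le: "ennreal (norm (f x - f y) / k x y) * I x y \<le> g x y + g y x" for x y
  proof -
    have "norm (f x - f y) \<le> norm (f x - f (m x y)) + norm (f y - f (m x y))"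
      using norm_triangle_ineq4[of "f x - f (m x y)" "f y - f (m x y)"] by simp
    then have "norm (f x - f y) / k x y \<le> norm (f x - f (m x y)) / k x y + norm (f y - f (m x y)) / k x y"
      by (simp add: k_def divide_right_mono flip: add_divide_distrib)
    then have "ennreal (norm (f x - f y) / k x y) \<le> ennreal (norm (f x - f (m x y)) / k x y) + ennreal (norm (f y - f (m x y)) / k x y)"
      by (subst ennreal_plus[symmetric]) (simp_all only: ennreal_leI, simp_all add: k_def)
    then show ?thesis
      unfolding g_def sym(1)[of y x] sym(2)[of y x] sym(3)[of y x] distrib_right[symmetric]
      by (rule mult_right_mono) simp
  qed
  have half: "(\<integral>\<^sup>+y. g x y \<partial>lborel) \<le> ennreal (2 powr (- \<alpha>)) *
      (\<integral>\<^sup>+z. ennreal (norm (f x - f z) / k x z) * indicator B x * indicator B z * indicator {0..<R/2} (norm (x - z)) \<partial>lborel)"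
    (is "_ \<le> _ * ?R") for x
  proof -
    have "(\<integral>\<^sup>+y. g x y \<partial>lborel) = ennreal (2 ^ DIM('a)) * (\<integral>\<^sup>+z. g x ((-x) + 2 *\<^sub>R z) \<partial>lborel)"
      using nn_integral_lborel_affine[of "g x" 2 "-x"] by simp
    also have "\<dots> \<le> ennreal (2 ^ DIM('a)) *
      (\<integral>\<^sup>+z. ennreal (2 powr - (real DIM('a) + \<alpha>)) * (ennreal (norm (f x - f z) / k x z) * indicator B x * indicator B z * indicator {0..<R/2} (norm (x - z))) \<partial>lborel)"
    proof (intro mult_left_mono nn_integral_mono)
      fix z
      define y where "y = (-x) + 2 *\<^sub>R z"
      have mz: "m x y = z"
        by (simp add: m_def y_def algebra_simps flip: scaleR_add_left)
      have "x - y = 2 *\<^sub>R (x - z)" by (simp add: y_def algebra_simps scaleR_2)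
      then have nz: "norm (x - y) = 2 * norm (x - z)" by simp
      have kz: "norm (f x - f z) / k x y = 2 powr - (real DIM('a) + \<alpha>) * (norm (f x - f z) / k x z)"
        unfolding k_def nz powr_minus by (simp add: powr_mult divide_inverse)
      have "I x y \<le> indicator B x * indicator B z * indicator {0..<R/2} (norm (x - z))"
        using convexD[OF B, of x y "1/2" "1/2"] mz
        by (auto simp: I_def nz m_def split: split_indicator)
      then have "g x y \<le> ennreal (norm (f x - f z) / k x y) * (indicator B x * indicator B z * indicator {0..<R/2} (norm (x - z)))"
        unfolding g_def mz by (rule mult_left_mono) simp
      then show "g x (-x + 2 *\<^sub>R z) \<le> ennreal (2 powr - (real DIM('a) + \<alpha>)) *
           (ennreal (norm (f x - f z) / k x z) * indicator B x * indicator B z * indicator {0..<R/2} (norm (x - z)))"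
        unfolding y_def[symmetric] kz
        by (subst (asm) ennreal_mult) (simp_all add: mult.assoc k_def)
    qed simp
    also have "\<dots> = ennreal (2 ^ DIM('a)) * (ennreal (2 powr - (real DIM('a) + \<alpha>)) * ?R)"
      by (subst nn_integral_cmult) auto
    also have "\<dots> = ennreal (2 powr (- \<alpha>)) * ?R"
    proof -
      have "2 ^ DIM('a) * 2 powr - (real DIM('a) + \<alpha>) = 2 powr - \<alpha>"
        by (simp add: powr_diff powr_realpow powr_minus field_simps)
      then show ?thesis
        by (simp add: mult.assoc[symmetric] ennreal_mult[symmetric])
    qed
    finally show ?thesis .
  qed
  have "gagliardo_between 0 R \<alpha> B f = (\<integral>\<^sup>+x. \<integral>\<^sup>+y. ennreal (norm (f x - f y) / k x y) * I x y \<partial>lborel \<partial>lborel)"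
    unfolding gagliardo_between_def k_def I_def by (simp add: mult.assoc)
  also have "\<dots> \<le> (\<integral>\<^sup>+x. \<integral>\<^sup>+y. g x y + g y x \<partial>lborel \<partial>lborel)"
    by (intro nn_integral_mono le)
  also have "\<dots> = (\<integral>\<^sup>+x. \<integral>\<^sup>+y. g x y \<partial>lborel \<partial>lborel) + (\<integral>\<^sup>+x. \<integral>\<^sup>+y. g y x \<partial>lborel \<partial>lborel)"
    by (simp add: nn_integral_add)
  also have "(\<integral>\<^sup>+x. \<integral>\<^sup>+y. g y x \<partial>lborel \<partial>lborel) = (\<integral>\<^sup>+x. \<integral>\<^sup>+y. g x y \<partial>lborel \<partial>lborel)"
    by (rule lborel_pair.Fubini') simp
  also have "(\<integral>\<^sup>+x. \<integral>\<^sup>+y. g x y \<partial>lborel \<partial>lborel) + (\<integral>\<^sup>+x. \<integral>\<^sup>+y. g x y \<partial>lborel \<partial>lborel) =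
      ennreal 2 * (\<integral>\<^sup>+x. \<integral>\<^sup>+y. g x y \<partial>lborel \<partial>lborel)"
    by (simp flip: mult_2)
  also have "\<dots> \<le> ennreal 2 * (\<integral>\<^sup>+x. ennreal (2 powr (- \<alpha>)) *
      (\<integral>\<^sup>+z. ennreal (norm (f x - f z) / k x z) * indicator B x * indicator B z * indicator {0..<R/2} (norm (x - z)) \<partial>lborel) \<partial>lborel)"
    by (intro mult_left_mono nn_integral_mono half) auto
  also have "\<dots> = ennreal 2 * (ennreal (2 powr (- \<alpha>)) * gagliardo_between 0 (R / 2) \<alpha> B f)"
    unfolding gagliardo_between_def k_def by (subst nn_integral_cmult) auto
  also have "\<dots> = ennreal (2 powr (1 - \<alpha>)) * gagliardo_between 0 (R / 2) \<alpha> B f"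
  proof -
    have "2 * 2 powr - \<alpha> = (2::real) powr (1 - \<alpha>)"
      by (simp add: powr_diff powr_minus field_simps)
    then show ?thesis
      by (simp add: mult.assoc[symmetric] ennreal_mult[symmetric] del: ennreal_numeral)
  qed
  finally show ?thesis .
qed

text \<open>
  Three halvings leave at least the fraction \<open>2\<^bsup>-3(1 - \<alpha>)\<^esup>\<close> of the energy on distances below \<open>R / 8\<close>, so
  little is left above. This is the only source of the factor \<open>1 - \<alpha>\<close>.
\<close>

lemma gagliardo_shell_le:
  fixes B :: "'a::euclidean_space set"
  assumes f: "f \<in> borel_measurable borel" and B: "B \<in> sets borel" "convex B"
    and \<alpha>: "\<alpha> < 1" and R: "0 \<le> R"
  shows "gagliardo_between (R / 8) R \<alpha> B f \<le> ennreal (3 * (1 - \<alpha>)) * gagliardo \<alpha> B f"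
proof (cases "gagliardo \<alpha> B f")
  case top
  then show ?thesis using \<alpha> by (simp add: ennreal_mult_top)
next
  case (real G)
  let ?N = "\<lambda>R. gagliardo_between 0 R \<alpha> B f"
  let ?c = "2 powr (1 - \<alpha>) :: real"
  have fin: "gagliardo_between r s \<alpha> B f < \<infinity>" for r s
    using gagliardo_between_le[of r s \<alpha> B f] real by (auto simp: less_top[symmetric] top_unique)
  obtain a where a: "0 \<le> a" "?N (R / 8) = ennreal a" using fin[of 0 "R/8"] by (cases "?N (R/8)") auto
  obtain b where b: "0 \<le> b" "gagliardo_between (R / 8) R \<alpha> B f = ennreal b"
    using fin[of "R/8" R] by (cases "gagliardo_between (R / 8) R \<alpha> B f") auto
  have ab: "?N R = ennreal (a + b)"
    using gagliardo_between_split[OF f B(1), of 0 "R/8" R \<alpha>] a b R by simp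
  have "ennreal (a + b) \<le> ennreal ?c * (ennreal ?c * (ennreal ?c * ?N (R / 8)))"
  proof -
    have "?N R \<le> ennreal ?c * ?N (R / 2)"
      by (rule gagliardo_between_halve[OF f B])
    also have "?N (R / 2) \<le> ennreal ?c * ?N (R / 4)"
      using gagliardo_between_halve[OF f B, of "R/2"] by simp
    also have "?N (R / 4) \<le> ennreal ?c * ?N (R / 8)"
      using gagliardo_between_halve[OF f B, of "R/4"] by simp
    finally show ?thesis unfolding ab by (simp add: mult_left_mono)
  qed
  then have "a + b \<le> 2 powr (3 * (1 - \<alpha>)) * a"
  proof -
    have "?c * (?c * ?c) = 2 powr (3 * (1 - \<alpha>))"
      by (simp add: powr_add[symmetric])
    then have "ennreal ?c * (ennreal ?c * (ennreal ?c * ?N (R / 8))) = ennreal (2 powr (3 * (1 - \<alpha>)) * a)"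
      using a by (simp add: mult.assoc[symmetric] ennreal_mult[symmetric])
    with \<open>ennreal (a + b) \<le> _\<close> show ?thesis using a by simp
  qed
  then have 1: "2 powr - (3 * (1 - \<alpha>)) * (a + b) \<le> a"
    unfolding powr_minus by (simp add: field_simps)
  have "1 - 3 * (1 - \<alpha>) \<le> 1 - 3 * (1 - \<alpha>) * ln 2"
    using \<alpha> ln_2_less_1 by (intro diff_left_mono mult_left_le) auto
  also have "\<dots> \<le> 2 powr - (3 * (1 - \<alpha>))"
    using exp_ge_add_one_self[of "- (3 * (1 - \<alpha>)) * ln 2"] by (simp add: powr_def algebra_simps)
  finally have "(1 - 3 * (1 - \<alpha>)) * (a + b) \<le> 2 powr - (3 * (1 - \<alpha>)) * (a + b)"
    using a b by (intro mult_right_mono) auto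
  with 1 have "b \<le> 3 * (1 - \<alpha>) * (a + b)" by (simp add: algebra_simps)
  also have "a + b \<le> G"
    using gagliardo_between_le[of 0 R \<alpha> B f] ab real by (simp del: ennreal_plus)
  finally have "b \<le> 3 * (1 - \<alpha>) * G" using \<alpha> by (simp add: mult_left_mono)
  then show ?thesis
    using b real \<alpha> by (simp flip: ennreal_mult)
qed

section \<open>The relative fractional isoperimetric inequality\<close>

lemma measure_ball_scale:
  fixes x :: "'a::euclidean_space"
  shows "0 \<le> r \<Longrightarrow> measure lborel (ball x r) = r ^ DIM('a) * measure lborel (ball (0::'a) 1)"
  using content_ball_conv_unit_ball[of r x] by simp

definition isoperimetric_const :: "'a::euclidean_space itself \<Rightarrow> real" where
  "isoperimetric_const _ = 6 * (1 + 2 ^ (DIM('a) + 1) / measure lborel (ball (0::'a) 1))\<^sup>2"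

lemma isoperimetric_const_pos: "0 < isoperimetric_const TYPE('a::euclidean_space)"
  unfolding isoperimetric_const_def by (intro mult_pos_pos zero_less_power add_pos_nonneg) auto

text \<open>
  Only distances between \<open>r / 8\<close> and \<open>r\<close> are used, where \<open>r = 2 \<rho> l\<close> and \<open>l\<close> is such that a ball of radius
  \<open>l \<rho>\<close> has volume \<open>2 |E|\<close>. For \<open>x \<in> E\<close> the ball of radius \<open>l \<rho>\<close> around \<open>(1 - l) x\<close> lies in the big
  ball and within distance \<open>r\<close> of \<open>x\<close>; removing \<open>E\<close> and the points within \<open>r / 8\<close> of \<open>x\<close>, whose volume is at most
  \<open>|E| / 2\<close>, leaves at least \<open>|E| / 2\<close>. So the energy at these distances is at least
  \<open>r\<^bsup>-(n + \<alpha>)\<^esup> |E|\<^sup>2 / 2\<close>, which is comparable to \<open>|E|\<^bsup>1 - \<alpha>/n\<^esup>\<close>. The hypothesis on \<open>|E|\<close> means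
  \<open>l \<le> 1\<close>.
\<close>

lemma relative_fractional_isoperimetric:
  fixes E :: "'a::euclidean_space set"
  assumes E[measurable]: "E \<in> sets borel" and EB: "E \<subseteq> ball 0 \<rho>"
    and small: "2 * measure lborel E \<le> measure lborel (ball (0::'a) \<rho>)"
    and \<rho>: "0 < \<rho>" and \<alpha>: "0 < \<alpha>" "\<alpha> < 1"
  shows "ennreal (measure lborel E powr (1 - \<alpha> / DIM('a))) \<le>
    ennreal (isoperimetric_const TYPE('a) * (1 - \<alpha>)) * gagliardo \<alpha> (ball 0 \<rho>) (indicator E :: 'a \<Rightarrow> real)"
proof (cases "measure lborel E = 0")
  case True
  then show ?thesis by simp
next
  case False
  define n where "n = DIM('a)"
  define e where "e = measure lborel E"
  define v where "v = measure lborel (ball (0::'a) 1)"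
  let ?G = "gagliardo \<alpha> (ball 0 \<rho>) (indicator E :: 'a \<Rightarrow> real)"
  have n: "0 < n" by (simp add: n_def)
  have e: "0 < e" using False by (simp add: e_def zero_less_measure_iff)
  have v: "0 < v" by (simp add: v_def content_ball_pos)
  have ball: "measure lborel (ball x s) = s ^ n * v" if "0 \<le> s" for x :: 'a and s
    using measure_ball_scale[OF that, of x] by (simp add: n_def v_def)
  have Efin: "emeasure lborel E < \<infinity>"
    using emeasure_mono[OF EB, of lborel] emeasure_lborel_ball_finite[of "0::'a" \<rho>] by (auto simp: less_top[symmetric] top_unique)
  have Ee: "emeasure lborel E = ennreal e"
    using Efin by (simp add: e_def emeasure_eq_ennreal_measure)
  define l where "l = (2 * e / (\<rho> ^ n * v)) powr (1 / n)"
  have l0: "0 < l" using e \<rho> v by (simp add: l_def)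
  have ln: "l ^ n = 2 * e / (\<rho> ^ n * v)"
    using l0 e \<rho> v n by (simp add: l_def powr_powr flip: powr_realpow)
  have l1: "l \<le> 1"
  proof -
    have "2 * e / (\<rho> ^ n * v) \<le> 1"
      using small \<rho> v by (simp add: ball e_def)
    then show ?thesis unfolding l_def using e \<rho> v by (intro powr_le1) auto
  qed
  define r where "r = 2 * \<rho> * l"
  have r0: "0 < r" using \<rho> l0 by (simp add: r_def)
  have rn: "r ^ n = 2 ^ (n + 1) / v * e"
    using \<rho> v by (simp add: r_def power_mult_distrib ln)
  define S where "S x = ball ((1 - l) *\<^sub>R x) (l * \<rho>) - E - ball x (r / 8)" for x
  have Sm[measurable]: "S x \<in> sets borel" for x by (simp add: S_def)
  have S: "ennreal (e / 2) \<le> emeasure lborel (S x)" for x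
  proof -
    have fm: "ball y s \<in> fmeasurable lborel" "E \<in> fmeasurable lborel" "S x \<in> fmeasurable lborel" for y :: 'a and s
    proof -
      show ball: "ball y s \<in> fmeasurable lborel" for y :: 'a and s
        using emeasure_lborel_ball_finite[of y s] by (intro fmeasurableI) auto
      show "E \<in> fmeasurable lborel"
        using Efin by (intro fmeasurableI) auto
      show "S x \<in> fmeasurable lborel"
        by (rule fmeasurableI2[OF ball[of "(1 - l) *\<^sub>R x" "l * \<rho>"]]) (auto simp: S_def)
    qed
    have "2 * e = measure lborel (ball ((1 - l) *\<^sub>R x) (l * \<rho>))"
      using l0 \<rho> v by (simp add: ball power_mult_distrib ln)
    also have "\<dots> \<le> measure lborel (S x \<union> E \<union> ball x (r / 8))"
      using fm by (intro measure_mono_fmeasurable) (auto simp: S_def)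
    also have "\<dots> \<le> measure lborel (S x \<union> E) + measure lborel (ball x (r / 8))"
      using fm by (intro measure_Un_le) (auto simp: fmeasurable_def)
    also have "\<dots> \<le> measure lborel (S x) + e + measure lborel (ball x (r / 8))"
      using fm by (auto simp: fmeasurable_def e_def intro!: measure_Un_le)
    \<comment> \<open>As \<open>r / 8 = l \<rho> / 4\<close>, this ball is the one of volume \<open>2 e\<close> shrunk by 4.\<close>
    also have "measure lborel (ball x (r / 8)) = 2 * (1/4) ^ n * e"
    proof -
      have "(8::real) ^ n = 2 ^ n * 4 ^ n" by (simp flip: power_mult_distrib)
      then show ?thesis using r0 v by (simp add: ball power_divide rn field_simps)
    qed
    also have "\<dots> \<le> 2 * (1/4) * e"
      using e n power_decreasing[of 1 n "1/4::real"] by (intro mult_right_mono) auto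
    finally have "e / 2 \<le> measure lborel (S x)" by simp
    then have "ennreal (e / 2) \<le> ennreal (measure lborel (S x))" by (rule ennreal_leI)
    then show ?thesis by (simp add: emeasure_eq_measure2[OF fm(3)])
  qed
  have xy: "y \<in> ball 0 \<rho> \<and> y \<notin> E \<and> norm (x - y) \<in> {r / 8..<r}" if "x \<in> E" "y \<in> S x" for x y
  proof -
    have x: "norm x < \<rho>" using that EB by auto
    have y: "norm (y - (1 - l) *\<^sub>R x) < l * \<rho>" using that by (simp add: S_def dist_norm norm_minus_commute)
    have "norm y \<le> norm (y - (1 - l) *\<^sub>R x) + norm ((1 - l) *\<^sub>R x)"
      using norm_triangle_ineq[of "y - (1 - l) *\<^sub>R x" "(1 - l) *\<^sub>R x"] by simp
    also have "\<dots> < l * \<rho> + (1 - l) * norm x" using y l1 by simp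
    also have "\<dots> \<le> l * \<rho> + (1 - l) * \<rho>" using x l1 by (intro add_left_mono mult_left_mono) auto
    finally have y\<rho>: "norm y < \<rho>" by (simp add: algebra_simps)
    have "norm (y - x) \<le> norm (y - (1 - l) *\<^sub>R x) + norm (l *\<^sub>R x)"
      using norm_triangle_ineq4[of "y - (1 - l) *\<^sub>R x" "l *\<^sub>R x"] by (simp add: algebra_simps)
    then have "norm (y - x) < l * \<rho> + l * norm x" using y l0 by simp
    also have "\<dots> \<le> l * \<rho> + l * \<rho>" using x l0 by simp
    finally have "norm (x - y) < r" by (simp add: r_def norm_minus_commute)
    then show ?thesis using that y\<rho> by (auto simp: S_def dist_norm)
  qed
  define q where "q = r powr - (real n + \<alpha>)"
  have "ennreal (q * (e / 2) * e) = (\<integral>\<^sup>+x. ennreal (q * (e / 2)) * indicator E x \<partial>lborel)"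
    using e by (simp add: nn_integral_cmult Ee q_def flip: ennreal_mult)
  also have "\<dots> \<le> (\<integral>\<^sup>+x. \<integral>\<^sup>+y. ennreal q * indicator E x * indicator (S x) y \<partial>lborel \<partial>lborel)"
  proof (rule nn_integral_mono)
    fix x
    have "ennreal (q * (e / 2)) \<le> ennreal q * emeasure lborel (S x)"
      using e by (subst ennreal_mult) (auto simp only: q_def powr_ge_zero intro!: mult_left_mono S, simp_all)
    then show "ennreal (q * (e / 2)) * indicator E x \<le> (\<integral>\<^sup>+y. ennreal q * indicator E x * indicator (S x) y \<partial>lborel)"
      by (subst nn_integral_cmult) (auto split: split_indicator)
  qed
  also have "\<dots> \<le> gagliardo_between (r / 8) r \<alpha> (ball 0 \<rho>) (indicator E :: 'a \<Rightarrow> real)"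
    unfolding gagliardo_between_def
  proof (intro nn_integral_mono)
    fix x y
    show "ennreal q * indicator E x * indicator (S x) y \<le>
      ennreal (norm ((indicator E x :: real) - indicator E y) / norm (x - y) powr (real DIM('a) + \<alpha>)) *
        indicator (ball 0 \<rho>) x * indicator (ball 0 \<rho>) y * indicator {r / 8..<r} (norm (x - y))"
    proof (cases "x \<in> E \<and> y \<in> S x")
      case True
      note p = xy[of x y] True
      have "norm (x - y) powr (real n + \<alpha>) \<le> r powr (real n + \<alpha>)" "0 < norm (x - y) powr (real n + \<alpha>)"
        using p r0 \<alpha> by (auto intro!: powr_mono2)
      then have "q \<le> 1 / norm (x - y) powr (real n + \<alpha>)"
        unfolding q_def powr_minus by (metis le_imp_inverse_le inverse_eq_divide)
      then show ?thesis using p EB by (auto simp: n_def intro!: ennreal_leI)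
    qed auto
  qed
  also have "\<dots> \<le> ennreal (3 * (1 - \<alpha>)) * ?G"
    using \<alpha> r0 by (intro gagliardo_shell_le) auto
  finally have main: "ennreal (q * (e / 2) * e) \<le> ennreal (3 * (1 - \<alpha>)) * ?G" .
  \<comment> \<open>\<open>2 ^ (n + 1) / v\<close> is raised to a power between 1 and 2; adding 1 makes the square a bound for all \<open>\<alpha>\<close>.\<close>
  define K where "K = (1 + 2 ^ (n + 1) / v)\<^sup>2"
  have K1: "0 < 1 + 2 ^ (n + 1) / v" using v by (intro add_pos_pos) auto
  then have K: "0 < K" unfolding K_def by (rule zero_less_power)
  have "r powr (real n + \<alpha>) = (r ^ n) powr (1 + \<alpha> / n)"
  proof -
    have "real n * (1 + \<alpha> / n) = real n + \<alpha>" using n by (simp add: distrib_left)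
    then show ?thesis by (metis powr_powr powr_realpow r0)
  qed
  also have "\<dots> = (2 ^ (n + 1) / v) powr (1 + \<alpha> / n) * e powr (1 + \<alpha> / n)"
    unfolding rn using v e by (subst powr_mult) auto
  finally have r_eq: "r powr (real n + \<alpha>) = (2 ^ (n + 1) / v) powr (1 + \<alpha> / n) * e powr (1 + \<alpha> / n)" .
  have "(2 ^ (n + 1) / v) powr (1 + \<alpha> / n) \<le> (1 + 2 ^ (n + 1) / v) powr (1 + \<alpha> / n)"
    using v \<alpha> by (intro powr_mono2) auto
  also have "\<dots> \<le> (1 + 2 ^ (n + 1) / v) powr 2"
    using v \<alpha> n by (intro powr_mono) (auto simp: field_simps)
  also have "\<dots> = K"
    using K1 unfolding K_def by (rule powr_numeral[OF less_imp_le])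
  finally have rK: "r powr (real n + \<alpha>) \<le> K * e powr (1 + \<alpha> / n)"
    unfolding r_eq by (rule mult_right_mono) simp
  have "e powr (1 - \<alpha> / n) * e powr (1 + \<alpha> / n) = e * e"
    using e by (simp add: powr_add[symmetric] power2_eq_square)
  then have "e powr (1 - \<alpha> / n) * r powr (real n + \<alpha>) \<le> K * (e * e)"
    using mult_left_mono[OF rK, of "e powr (1 - \<alpha> / n)"] by (simp add: algebra_simps)
  then have "e powr (1 - \<alpha> / n) \<le> 2 * K * (q * (e / 2) * e)"
    unfolding q_def powr_minus using r0 by (simp add: field_simps)
  then have "ennreal (e powr (1 - \<alpha> / n)) \<le> ennreal (2 * K) * ennreal (q * (e / 2) * e)"
    using K e by (simp add: ennreal_leI q_def flip: ennreal_mult)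
  also have "\<dots> \<le> ennreal (2 * K) * (ennreal (3 * (1 - \<alpha>)) * ?G)"
    by (intro mult_left_mono main) simp
  also have "\<dots> = ennreal (2 * K * (3 * (1 - \<alpha>))) * ?G"
    using K \<alpha> by (subst (3) ennreal_mult) (auto simp: mult.assoc)
  also have "2 * K * (3 * (1 - \<alpha>)) = 6 * K * (1 - \<alpha>)" by simp
  finally show ?thesis by (simp add: isoperimetric_const_def K_def n_def v_def e_def)
qed

section \<open>Integrals of weak-type functions\<close>

lemma nn_integral_layer_cake:
  fixes h :: "'a \<Rightarrow> real"
  assumes "sigma_finite_measure M" and [measurable]: "h \<in> borel_measurable M" "E \<in> sets M"
  shows "(\<integral>\<^sup>+x. ennreal (h x) * indicator E x \<partial>M) =
    (\<integral>\<^sup>+t. emeasure M {x \<in> E. t < h x} * indicator {0..} t \<partial>lborel)"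
proof -
  interpret sigma_finite_measure M by fact
  interpret pair_sigma_finite M lborel ..
  have sp: "{x \<in> E. t < h x} = {x \<in> space M. x \<in> E \<and> t < h x}" for t
    using sets.sets_into_space[OF assms(3)] by auto
  have sets: "{x \<in> E. t < h x} \<in> sets M" for t
    unfolding sp by measurable
  have "ennreal (h x) * indicator E x =
      (\<integral>\<^sup>+t. indicator E x * indicator {0..<h x} t \<partial>lborel)" for x
    by (subst nn_integral_cmult, simp, cases "0 \<le> h x")
       (auto simp: emeasure_lborel_Ico ennreal_neg split: split_indicator)
  then have "(\<integral>\<^sup>+x. ennreal (h x) * indicator E x \<partial>M) =
      (\<integral>\<^sup>+x. \<integral>\<^sup>+t. indicator E x * indicator {0..<h x} t \<partial>lborel \<partial>M)"
    by simp
  also have "\<dots> = (\<integral>\<^sup>+x. \<integral>\<^sup>+t. indicator E x * (indicator {0..} t * indicator {0<..} (h x - t)) \<partial>lborel \<partial>M)"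
    by (intro nn_integral_cong) (auto split: split_indicator)
  also have "\<dots> = (\<integral>\<^sup>+t. \<integral>\<^sup>+x. indicator E x * (indicator {0..} t * indicator {0<..} (h x - t)) \<partial>M \<partial>lborel)"
    by (intro Fubini'[symmetric]) measurable
  also have "\<dots> = (\<integral>\<^sup>+t. \<integral>\<^sup>+x. indicator {0..} t * indicator {x \<in> E. t < h x} x \<partial>M \<partial>lborel)"
    by (intro nn_integral_cong) (auto split: split_indicator)
  also have "\<dots> = (\<integral>\<^sup>+t. emeasure M {x \<in> E. t < h x} * indicator {0..} t \<partial>lborel)"
    using sets by (intro nn_integral_cong, subst nn_integral_cmult) (auto simp: mult.commute)
  finally show ?thesis .
qed

lemma nn_integral_powr_atLeast:
  fixes a s :: real
  assumes a: "0 < a" and s: "0 < s"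
  shows "(\<integral>\<^sup>+t. ennreal (t powr (- a - 1)) * indicator {s..} t \<partial>lborel) = ennreal (s powr - a / a)"
proof -
  have "(\<integral>\<^sup>+t. ennreal (t powr (- a - 1)) * indicator {s..} t \<partial>lborel) = ennreal (0 - - 1 / a * s powr - a)"
  proof (rule nn_integral_FTC_atLeast)
    show "((\<lambda>t. - 1 / a * t powr - a) has_real_derivative t powr (- a - 1)) (at t)" if "s \<le> t" for t
    proof -
      have "((\<lambda>t. t powr - a) has_real_derivative (- a) * t powr (- a - 1)) (at t)"
        using that s by (intro has_real_derivative_powr) auto
      from DERIV_cmult[OF this, of "- 1 / a"] show ?thesis using a by simp
    qed
    show "((\<lambda>t. - 1 / a * t powr - a) \<longlongrightarrow> 0) at_top"
      using a by (intro tendsto_mult_right_zero tendsto_neg_powr filterlim_ident) auto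
  qed auto
  then show ?thesis by simp
qed

lemma nn_integral_powr_greaterThan:
  fixes a s :: real
  assumes a: "0 < a" and s: "0 < s"
  shows "(\<integral>\<^sup>+t. ennreal (t powr (- a - 1)) * indicator {s<..} t \<partial>lborel) = ennreal (s powr - a / a)"
proof -
  have "(\<integral>\<^sup>+t. ennreal (t powr (- a - 1)) * indicator {s<..} t \<partial>lborel) =
      (\<integral>\<^sup>+t. ennreal (t powr (- a - 1)) * indicator {s..} t \<partial>lborel)"
    by (intro nn_integral_cong_AE eventually_mono[OF AE_lborel_singleton[of s]]) (auto split: split_indicator)
  then show ?thesis using nn_integral_powr_atLeast[OF assms] by simp
qed

text \<open>
  The half of the duality between \<open>L\<^bsup>p,\<infinity>\<^esup>\<close> and \<open>L\<^bsup>p',1\<^esup>\<close> that concerns indicator functions. In the layer cake formula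
  the distribution function is bounded by \<open>e\<close> below the height \<open>T\<close> where the two bounds agree, and by the
  weak-type bound above it. The second part carries the factor \<open>1 / (p - 1)\<close>; \<open>p \<ge> 2\<close> makes the constant
  absolute.
\<close>

lemma weak_type_integral_le:
  fixes h :: "'a \<Rightarrow> real"
  assumes M: "sigma_finite_measure M" and [measurable]: "h \<in> borel_measurable M" "E \<in> sets M"
    and e: "emeasure M E = ennreal e" "0 \<le> e" and A: "0 \<le> A" and p: "2 \<le> p"
    and weak: "\<And>t. 0 < t \<Longrightarrow> emeasure M {x \<in> E. t < h x} \<le> ennreal (A * t powr - p)"
  shows "(\<integral>\<^sup>+x. ennreal (h x) * indicator E x \<partial>M) \<le> ennreal (2 * A powr (1 / p) * e powr (1 - 1 / p))"
proof -
  have triv: "emeasure M {x \<in> E. t < h x} \<le> ennreal e" for t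
    unfolding e(1)[symmetric] by (intro emeasure_mono) auto
  show ?thesis
  proof (cases "A = 0 \<or> e = 0")
    case True
    have ae: "AE t in lborel. t \<noteq> (0::real)"
      by (rule AE_lborel_singleton)
    have "emeasure M {x \<in> E. t < h x} * indicator {0..} t = 0" if "t \<noteq> 0" for t
      using True triv[of t] weak[of t] that by (cases "0 < t") auto
    then have "(\<integral>\<^sup>+t. emeasure M {x \<in> E. t < h x} * indicator {0..} t \<partial>lborel) = (\<integral>\<^sup>+t. 0 \<partial>(lborel::real measure))"
      using ae by (intro nn_integral_cong_AE) auto
    then show ?thesis by (simp add: nn_integral_layer_cake[OF M])
  next
    case False
    then have A0: "0 < A" and e0: "0 < e" using A e by auto
    \<comment> \<open>The height where the trivial bound \<open>e\<close> and the weak-type bound balance.\<close>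
    define T where "T = (A / e) powr (1 / p)"
    have T: "0 < T" using A0 e0 by (simp add: T_def)
    have "(\<integral>\<^sup>+t. emeasure M {x \<in> E. t < h x} * indicator {0..} t \<partial>lborel) \<le>
       (\<integral>\<^sup>+t. ennreal e * indicator {0..<T} t + ennreal (A * t powr - p) * indicator {T..} t \<partial>lborel)"
      using triv weak T by (intro nn_integral_mono) (auto split: split_indicator)
    also have "\<dots> = ennreal (e * T) + (\<integral>\<^sup>+t. ennreal (A * t powr - p) * indicator {T..} t \<partial>lborel)"
      using T e0 by (subst nn_integral_add) (auto simp: nn_integral_cmult emeasure_lborel_Ico ennreal_mult)
    also have "(\<integral>\<^sup>+t. ennreal (A * t powr - p) * indicator {T..} t \<partial>lborel) =
        ennreal (A * T powr (1 - p) / (p - 1))"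
    proof -
      have "(\<integral>\<^sup>+t. ennreal (A * t powr - p) * indicator {T..} t \<partial>lborel) =
          (\<integral>\<^sup>+t. ennreal A * (ennreal (t powr (- (p - 1) - 1)) * indicator {T..} t) \<partial>lborel)"
        using A by (intro nn_integral_cong) (simp add: ennreal_mult mult.assoc)
      also have "\<dots> = ennreal A * ennreal (T powr - (p - 1) / (p - 1))"
        using nn_integral_powr_atLeast[of "p - 1" T] T p by (subst nn_integral_cmult) auto
      finally show ?thesis using A p by (simp flip: ennreal_mult)
    qed
    also have "ennreal (e * T) + \<dots> = ennreal (e * T + A * T powr (1 - p) / (p - 1))"
      using e0 A0 T p by (subst ennreal_plus[symmetric]) auto
    also have "\<dots> \<le> ennreal (2 * A powr (1 / p) * e powr (1 - 1 / p))"
    proof (rule ennreal_leI)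
      have 1: "e * T = A powr (1 / p) * e powr (1 - 1 / p)"
        using A0 e0 by (simp add: T_def powr_divide powr_diff)
      have "A * T powr (1 - p) = A * (A / e) powr (1 / p - 1)"
        using p by (simp add: T_def powr_powr diff_divide_distrib)
      also have "\<dots> = A powr (1 / p) * e powr (1 - 1 / p)"
        using A0 e0 by (simp add: powr_divide powr_diff field_simps)
      finally have 2: "A * T powr (1 - p) = A powr (1 / p) * e powr (1 - 1 / p)" .
      have "A * T powr (1 - p) / (p - 1) \<le> A * T powr (1 - p) / 1"
        using p A0 by (intro divide_left_mono) auto
      with 1 2 show "e * T + A * T powr (1 - p) / (p - 1) \<le> 2 * A powr (1 / p) * e powr (1 - 1 / p)"
        by simp
    qed
    finally show ?thesis by (simp add: nn_integral_layer_cake[OF M])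
  qed
qed

section \<open>The coarea formula for the energy\<close>

text \<open>
  The level sets above \<open>s\<close> separate \<open>x\<close> and \<open>y\<close> for a set of levels of length \<open>|f x - f y|\<close>.
\<close>

lemma gagliardo_coarea:
  fixes f :: "'a::euclidean_space \<Rightarrow> real"
  assumes [measurable]: "f \<in> borel_measurable borel" "B \<in> sets borel"
  shows gagliardo_superlevel_measurable:
      "(\<lambda>s. gagliardo \<alpha> B (indicator {y. s < f y} :: 'a \<Rightarrow> real)) \<in> borel_measurable lborel"
    and "(\<integral>\<^sup>+s. gagliardo \<alpha> B (indicator {y. s < f y} :: 'a \<Rightarrow> real) \<partial>lborel) = gagliardo \<alpha> B f"
proof -
  define k where "k x y = norm (x - y) powr (real DIM('a) + \<alpha>)" for x y :: 'a
  define w where "w x y s = ennreal (norm ((indicator {0<..} (f x - s) :: real) - indicator {0<..} (f y - s)) / k x y) *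
      indicator B x * indicator B y" for x y s
  have G: "gagliardo \<alpha> B (indicator {y. s < f y} :: 'a \<Rightarrow> real) = (\<integral>\<^sup>+x. \<integral>\<^sup>+y. w x y s \<partial>lborel \<partial>lborel)" for s
    unfolding gagliardo_def w_def k_def by (intro nn_integral_cong) (auto split: split_indicator)
  show "(\<lambda>s. gagliardo \<alpha> B (indicator {y. s < f y} :: 'a \<Rightarrow> real)) \<in> borel_measurable lborel"
    unfolding G w_def k_def by measurable
  have "(\<integral>\<^sup>+s. gagliardo \<alpha> B (indicator {y. s < f y} :: 'a \<Rightarrow> real) \<partial>lborel) =
      (\<integral>\<^sup>+x. \<integral>\<^sup>+s. \<integral>\<^sup>+y. w x y s \<partial>lborel \<partial>lborel \<partial>lborel)"
    unfolding G by (rule lborel_pair.Fubini') (unfold w_def k_def, measurable)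
  also have "\<dots> = (\<integral>\<^sup>+x. \<integral>\<^sup>+y. \<integral>\<^sup>+s. w x y s \<partial>lborel \<partial>lborel \<partial>lborel)"
    by (intro nn_integral_cong lborel_pair.Fubini') (unfold w_def k_def, measurable)
  also have "\<dots> = gagliardo \<alpha> B f"
  proof -
    have "(\<integral>\<^sup>+s. w x y s \<partial>lborel) = ennreal (norm (f x - f y) / k x y) * indicator B x * indicator B y" for x y
    proof -
      have "w x y s = ennreal (1 / k x y) * indicator B x * indicator B y * indicator {min (f x) (f y)..<max (f x) (f y)} s" for s
        unfolding w_def by (auto split: split_indicator)
      then have "(\<integral>\<^sup>+s. w x y s \<partial>lborel) = ennreal (1 / k x y) * indicator B x * indicator B y * ennreal (max (f x) (f y) - min (f x) (f y))"
        by (simp add: nn_integral_cmult)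
      also have "max (f x) (f y) - min (f x) (f y) = norm (f x - f y)" by auto
      also have "ennreal (1 / k x y) * indicator B x * indicator B y * ennreal (norm (f x - f y)) =
          ennreal (norm (f x - f y) / k x y) * indicator B x * indicator B y"
        by (auto simp: k_def split: split_indicator simp flip: ennreal_mult)
      finally show ?thesis .
    qed
    then show ?thesis unfolding gagliardo_def k_def by simp
  qed
  finally show "(\<integral>\<^sup>+s. gagliardo \<alpha> B (indicator {y. s < f y} :: 'a \<Rightarrow> real) \<partial>lborel) = gagliardo \<alpha> B f" .
qed

section \<open>Oscillatory integrals over shells\<close>

lemma AE_norm_neq: "AE y in (lborel::'a::euclidean_space measure). norm y \<noteq> t"
proof -
  have "sphere (0::'a) t \<in> null_sets lborel"
    using negligible_sphere[of "0::'a" t]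
    by (auto simp: null_sets_completion_iff negligible_iff_null_sets)
  then show ?thesis by (rule AE_I') auto
qed

lemma ball_borel[measurable]: "ball x r \<in> sets (borel :: 'a::metric_space measure)"
  by simp

text \<open>
  The properties of the kernel in the form in which they are used: mean and distribution function are
  taken over the unit ball with Lebesgue measure instead of the sphere, which by homogeneity changes them only by
  the factor \<open>n\<close>, and \<open>\<Omega>\<close> is Borel measurable. Homogeneity is also required at \<open>y = 0\<close>, where it is trivial.
\<close>

locale rough_kernel =
  fixes \<Omega> :: "'a::euclidean_space \<Rightarrow> complex" and N \<alpha> :: real
  assumes \<Omega>_borel[measurable]: "\<Omega> \<in> borel_measurable borel"
    and homogeneous: "0 < r \<Longrightarrow> \<Omega> (r *\<^sub>R y) = \<Omega> y"
    and mean_unit_ball: "(LINT y|lborel. indicator (ball 0 1) y *\<^sub>R \<Omega> y) = 0"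
    and weak_unit_ball: "0 < t \<Longrightarrow> emeasure lborel {y \<in> ball 0 1. t < norm (\<Omega> y)} \<le> ennreal ((N / t) powr (DIM('a) / \<alpha>))"
    and N: "0 \<le> N" and \<alpha>: "0 < \<alpha>" "\<alpha> < 1" and dim: "2 \<le> DIM('a)"
begin

lemma weak_ball:
  assumes \<rho>: "0 < \<rho>" and t: "0 < t"
  shows "emeasure lborel {y \<in> ball 0 \<rho>. t < norm (\<Omega> y)} \<le>
    ennreal (\<rho> ^ DIM('a) * N powr (DIM('a) / \<alpha>) * t powr - (DIM('a) / \<alpha>))"
proof -
  define U where "U \<rho> = {y \<in> ball (0::'a) \<rho>. t < norm (\<Omega> y)}" for \<rho>
  have [measurable]: "U \<rho> \<in> sets borel" for \<rho>
    unfolding U_def by measurable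
  have "emeasure lborel (U \<rho>) = (\<integral>\<^sup>+y. indicator (U \<rho>) y \<partial>lborel)"
    by simp
  also have "\<dots> = ennreal (\<rho> ^ DIM('a)) * (\<integral>\<^sup>+y. indicator (U \<rho>) (\<rho> *\<^sub>R y) \<partial>lborel)"
    using nn_integral_lborel_affine[of "indicator (U \<rho>)" \<rho> 0] \<rho> by simp
  also have "(\<lambda>y. indicator (U \<rho>) (\<rho> *\<^sub>R y) :: ennreal) = indicator (U 1)"
    using \<rho> homogeneous[OF \<rho>] by (auto simp: U_def fun_eq_iff split: split_indicator)
  also have "(\<integral>\<^sup>+y. indicator (U 1) y \<partial>lborel) \<le> ennreal ((N / t) powr (DIM('a) / \<alpha>))"
    using weak_unit_ball[OF t] by (simp add: U_def)
  also have "ennreal (\<rho> ^ DIM('a)) * ennreal ((N / t) powr (DIM('a) / \<alpha>)) =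
      ennreal (\<rho> ^ DIM('a) * N powr (DIM('a) / \<alpha>) * t powr - (DIM('a) / \<alpha>))"
  proof -
    have "(N / t) powr (DIM('a) / \<alpha>) = N powr (DIM('a) / \<alpha>) * t powr - (DIM('a) / \<alpha>)"
      using N t by (simp add: powr_divide powr_minus_divide)
    then show ?thesis using \<rho> by (simp add: ennreal_mult[symmetric] mult.assoc)
  qed
  finally show ?thesis by (simp add: U_def mult_left_mono)
qed

lemma kernel_integral_le:
  assumes E[measurable]: "E \<in> sets borel" and EB: "E \<subseteq> ball 0 \<rho>" and \<rho>: "0 < \<rho>"
  shows "(\<integral>\<^sup>+y. ennreal (norm (\<Omega> y)) * indicator E y \<partial>lborel) \<le>
    ennreal (2 * \<rho> powr \<alpha> * N * measure lborel E powr (1 - \<alpha> / DIM('a)))"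
proof -
  let ?p = "DIM('a) / \<alpha>"
  have p: "2 \<le> ?p" using \<alpha> dim by (simp add: field_simps)
  have Efin: "emeasure lborel E < \<infinity>"
    using emeasure_mono[OF EB, of lborel] emeasure_lborel_ball_finite[of "0::'a" \<rho>]
    by (auto simp: less_top[symmetric] top_unique)
  have "(\<integral>\<^sup>+y. ennreal (norm (\<Omega> y)) * indicator E y \<partial>lborel) \<le>
      ennreal (2 * (\<rho> ^ DIM('a) * N powr ?p) powr (1 / ?p) * measure lborel E powr (1 - 1 / ?p))"
  proof (rule weak_type_integral_le[OF _ _ _ _ _ _ p])
    show "sigma_finite_measure (lborel :: 'a measure)" by standard
    show "emeasure lborel E = ennreal (measure lborel E)"
      using Efin by (simp add: emeasure_eq_ennreal_measure)
    show "emeasure lborel {x \<in> E. t < norm (\<Omega> x)} \<le> ennreal (\<rho> ^ DIM('a) * N powr ?p * t powr - ?p)"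
      if "0 < t" for t
      by (rule order_trans[OF emeasure_mono weak_ball[OF \<rho> that]]) (use EB in auto)
  qed (use \<rho> in auto)
  also have "(\<rho> ^ DIM('a) * N powr ?p) powr (1 / ?p) = \<rho> powr \<alpha> * N"
    using \<rho> N \<alpha> by (simp add: powr_mult powr_powr flip: powr_realpow)
  finally show ?thesis by (simp add: mult.assoc)
qed

lemma integrable_kernel:
  assumes E[measurable]: "E \<in> sets borel" and EB: "E \<subseteq> ball 0 \<rho>"
  shows "integrable lborel (\<lambda>y. indicator E y *\<^sub>R \<Omega> y)"
proof (cases "0 < \<rho>")
  case True
  have "(\<integral>\<^sup>+y. ennreal (norm (indicator E y *\<^sub>R \<Omega> y)) \<partial>lborel) = (\<integral>\<^sup>+y. ennreal (norm (\<Omega> y)) * indicator E y \<partial>lborel)"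
    by (intro nn_integral_cong) (auto split: split_indicator)
  also have "\<dots> < \<infinity>"
    using kernel_integral_le[OF assms True] by (auto simp: less_top[symmetric] top_unique)
  finally show ?thesis by (intro integrableI_bounded) auto
next
  case False
  then have "E = {}" using EB ball_empty[of \<rho> "0::'a"] by auto
  then show ?thesis by simp
qed

lemma mean_ball: "(LINT y|lborel. indicator (ball 0 \<rho>) y *\<^sub>R \<Omega> y) = 0"
proof (cases "0 < \<rho>")
  case True
  have m: "(\<lambda>y. indicator (ball 0 \<rho>) y *\<^sub>R \<Omega> y) \<in> borel_measurable borel"
    by measurable
  have "(LINT y|lborel. indicator (ball 0 \<rho>) y *\<^sub>R \<Omega> y) =
      (\<rho> ^ DIM('a)) *\<^sub>R (LINT y|lborel. indicator (ball 0 \<rho>) (\<rho> *\<^sub>R y) *\<^sub>R \<Omega> (\<rho> *\<^sub>R y))"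
    using lborel_integral_affine[OF m, of \<rho> 0] True by simp
  also have "(\<lambda>y. indicator (ball 0 \<rho>) (\<rho> *\<^sub>R y) *\<^sub>R \<Omega> (\<rho> *\<^sub>R y)) = (\<lambda>y. indicator (ball 0 1) y *\<^sub>R \<Omega> y)"
    using True homogeneous[OF True] by (auto simp: fun_eq_iff split: split_indicator)
  finally show ?thesis by (simp add: mean_unit_ball)
next
  case False
  then have e: "ball (0::'a) \<rho> = {}" by (intro ball_empty) simp
  show ?thesis unfolding e by simp
qed

definition shell :: "real \<Rightarrow> real \<Rightarrow> 'a set" where
  "shell t \<rho> = {y. t < norm y \<and> norm y < \<rho>}"

lemma shell_borel[measurable]: "shell t \<rho> \<in> sets borel"
  unfolding shell_def by measurable

lemma shell_subset: "shell t \<rho> \<subseteq> ball 0 \<rho>"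
  by (auto simp: shell_def)

text \<open>
  Up to the null sphere \<open>|y| = t\<close> a shell is the difference of two balls, on each of which the mean
  vanishes by scaling.
\<close>

lemma mean_shell: "(LINT y|lborel. indicator (shell t \<rho>) y *\<^sub>R \<Omega> y) = 0"
proof (cases "t < \<rho>")
  case True
  have "AE y in lborel. indicator (shell t \<rho>) y *\<^sub>R \<Omega> y =
      indicator (ball 0 \<rho>) y *\<^sub>R \<Omega> y - indicator (ball 0 t) y *\<^sub>R \<Omega> y"
    using True by (intro eventually_mono[OF AE_norm_neq[of t]]) (auto simp: shell_def split: split_indicator)
  then have "(LINT y|lborel. indicator (shell t \<rho>) y *\<^sub>R \<Omega> y) =
      (LINT y|lborel. indicator (ball 0 \<rho>) y *\<^sub>R \<Omega> y - indicator (ball 0 t) y *\<^sub>R \<Omega> y)"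
    by (intro integral_cong_AE) auto
  also have "\<dots> = 0"
    by (subst Bochner_Integration.integral_diff) (auto simp: mean_ball intro!: integrable_kernel)
  finally show ?thesis .
next
  case False
  then have "shell t \<rho> = {}" by (auto simp: shell_def)
  then show ?thesis by simp
qed

definition K :: "real \<Rightarrow> real" where
  "K \<rho> = 2 * \<rho> powr \<alpha> * N * (isoperimetric_const TYPE('a) * (1 - \<alpha>))"

lemma K_nonneg: "0 \<le> K \<rho>"
  using N \<alpha> isoperimetric_const_pos[where 'a='a] by (simp add: K_def)

text \<open>
  Passing to the complement of \<open>E\<close> in the ball changes the sign of the integral, because of the mean zero property, and
  preserves the energy. So \<open>E\<close> may be assumed to fill at most half of the ball, as the isoperimetric
  inequality demands.
\<close>

lemma shell_integral_indicator_le: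
  assumes E[measurable]: "E \<in> sets borel" and EB: "E \<subseteq> ball 0 \<rho>" and \<rho>: "0 < \<rho>"
  shows "ennreal (norm (LINT y|lborel. indicator (shell t \<rho> \<inter> E) y *\<^sub>R \<Omega> y)) \<le>
    ennreal (K \<rho>) * gagliardo \<alpha> (ball 0 \<rho>) (indicator E :: 'a \<Rightarrow> real)"
proof -
  let ?I = "\<lambda>E. LINT y|lborel. indicator (shell t \<rho> \<inter> E) y *\<^sub>R \<Omega> y"
  have small: "ennreal (norm (?I E)) \<le> ennreal (K \<rho>) * gagliardo \<alpha> (ball 0 \<rho>) (indicator E :: 'a \<Rightarrow> real)"
    if [measurable]: "E \<in> sets borel" and EB: "E \<subseteq> ball 0 \<rho>"
      and half: "2 * measure lborel E \<le> measure lborel (ball (0::'a) \<rho>)" for E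
  proof -
    have "ennreal (norm (?I E)) \<le> (\<integral>\<^sup>+y. ennreal (norm (indicator (shell t \<rho> \<inter> E) y *\<^sub>R \<Omega> y)) \<partial>lborel)"
      using EB by (intro integral_norm_bound_ennreal integrable_kernel[of _ \<rho>]) auto
    also have "\<dots> \<le> (\<integral>\<^sup>+y. ennreal (norm (\<Omega> y)) * indicator E y \<partial>lborel)"
      by (intro nn_integral_mono) (auto split: split_indicator)
    also have "\<dots> \<le> ennreal (2 * \<rho> powr \<alpha> * N * measure lborel E powr (1 - \<alpha> / DIM('a)))"
      by (rule kernel_integral_le[OF that(1) EB \<rho>])
    also have "\<dots> = ennreal (2 * \<rho> powr \<alpha> * N) * ennreal (measure lborel E powr (1 - \<alpha> / DIM('a)))"
      using N by (subst ennreal_mult) auto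
    also have "\<dots> \<le> ennreal (2 * \<rho> powr \<alpha> * N) * (ennreal (isoperimetric_const TYPE('a) * (1 - \<alpha>)) *
        gagliardo \<alpha> (ball 0 \<rho>) (indicator E :: 'a \<Rightarrow> real))"
      by (intro mult_left_mono relative_fractional_isoperimetric that \<rho> \<alpha>) simp
    also have "\<dots> = ennreal (K \<rho>) * gagliardo \<alpha> (ball 0 \<rho>) (indicator E :: 'a \<Rightarrow> real)"
      unfolding K_def using N \<alpha> isoperimetric_const_pos[where 'a='a]
      by (subst ennreal_mult[of _ "isoperimetric_const TYPE('a) * (1 - \<alpha>)"]) (auto simp: mult.assoc)
    finally show ?thesis .
  qed
  show ?thesis
  proof (cases "2 * measure lborel E \<le> measure lborel (ball (0::'a) \<rho>)")
    case True
    then show ?thesis using small[OF E EB] by simp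
  next
    case False
    let ?C = "ball 0 \<rho> - E"
    have "measure lborel ?C = measure lborel (ball (0::'a) \<rho>) - measure lborel E"
      using EB emeasure_lborel_ball_finite[of "0::'a" \<rho>] by (intro measure_Diff) auto
    then have C: "ennreal (norm (?I ?C)) \<le> ennreal (K \<rho>) * gagliardo \<alpha> (ball 0 \<rho>) (indicator ?C :: 'a \<Rightarrow> real)"
      using False by (intro small) auto
    have "?I E + ?I ?C = (LINT y|lborel. indicator (shell t \<rho> \<inter> E) y *\<^sub>R \<Omega> y + indicator (shell t \<rho> \<inter> ?C) y *\<^sub>R \<Omega> y)"
      using EB by (intro Bochner_Integration.integral_add[symmetric] integrable_kernel[of _ \<rho>]) auto
    also have "\<dots> = (LINT y|lborel. indicator (shell t \<rho>) y *\<^sub>R \<Omega> y)"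
      by (intro Bochner_Integration.integral_cong) (auto simp: shell_def split: split_indicator)
    finally have "?I E = - ?I ?C" by (simp add: mean_shell eq_neg_iff_add_eq_0)
    then have "norm (?I E) = norm (?I ?C)" by simp
    moreover have "gagliardo \<alpha> (ball 0 \<rho>) (indicator ?C :: 'a \<Rightarrow> real) = gagliardo \<alpha> (ball 0 \<rho>) (indicator E :: 'a \<Rightarrow> real)"
      unfolding gagliardo_def by (intro nn_integral_cong) (auto split: split_indicator)
    ultimately show ?thesis using C by simp
  qed
qed

text \<open>
  With \<open>f + M \<ge> 0\<close> written as the integral of the indicators of its superlevel sets, the estimate for sets
  applies at each level, and the coarea formula adds up the energies. The shift by \<open>M\<close> changes neither side, since \<open>\<Omega>\<close>
  has mean zero on the shell.
\<close>

lemma shell_integral_real_le: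
  fixes f :: "'a \<Rightarrow> real"
  assumes f[measurable]: "f \<in> borel_measurable borel" and M: "\<And>y. \<bar>f y\<bar> \<le> M" and \<rho>: "0 < \<rho>"
  shows "ennreal (norm (LINT y|lborel. indicator (shell t \<rho>) y *\<^sub>R f y *\<^sub>R \<Omega> y)) \<le>
    ennreal (K \<rho>) * gagliardo \<alpha> (ball 0 \<rho>) f"
proof -
  define E where "E s = {y \<in> ball 0 \<rho>. s < f y + M}" for s
  define h where "h y s = indicator {0..<f y + M} s *\<^sub>R indicator (shell t \<rho>) y *\<^sub>R \<Omega> y" for y and s :: real
  have E[measurable]: "E s \<in> sets borel" for s unfolding E_def by measurable
  have fM: "0 \<le> f y + M" "f y + M \<le> 2 * M" for y using M[of y] by auto
  have h_alt: "h y s = (indicator {0..} s * indicator {0<..} (f y + M - s)) *\<^sub>R indicator (shell t \<rho>) y *\<^sub>R \<Omega> y" for y s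
    by (auto simp: h_def split: split_indicator)
  have hm: "(\<lambda>(y, s). h y s) \<in> borel_measurable (lborel \<Otimes>\<^sub>M lborel)"
    unfolding h_alt by measurable
  have "(\<integral>\<^sup>+y. \<integral>\<^sup>+s. ennreal (norm (h y s)) \<partial>lborel \<partial>lborel) \<le>
      (\<integral>\<^sup>+y. \<integral>\<^sup>+s. ennreal (norm (\<Omega> y)) * indicator (ball 0 \<rho>) y * indicator {0..2 * M} s \<partial>lborel \<partial>lborel)"
    using fM shell_subset[of t \<rho>] by (intro nn_integral_mono) (auto simp: h_def split: split_indicator intro: order_trans less_imp_le dest: less_le_trans)
  also have "\<dots> = (\<integral>\<^sup>+y. ennreal (norm (\<Omega> y)) * indicator (ball 0 \<rho>) y \<partial>lborel) * ennreal (2 * M)"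
  proof -
    have "(\<integral>\<^sup>+s. ennreal (norm (\<Omega> y)) * indicator (ball 0 \<rho>) y * indicator {0..2 * M} s \<partial>lborel) =
        ennreal (norm (\<Omega> y)) * indicator (ball 0 \<rho>) y * ennreal (2 * M)" for y
      using fM[of 0] by (subst nn_integral_cmult) auto
    then show ?thesis by (simp add: nn_integral_multc del: ennreal_mult)
  qed
  also have "\<dots> < \<infinity>"
    using le_less_trans[OF kernel_integral_le[of "ball 0 \<rho>" \<rho>] ennreal_less_top] \<rho>
    by (simp add: ennreal_mult_less_top)
  finally have hint: "integrable (lborel \<Otimes>\<^sub>M lborel) (\<lambda>(y, s). h y s)"
    using hm by (intro integrableI_bounded) (simp_all add: lborel.nn_integral_fst[symmetric] split_beta')
  have "(LINT s|lborel. h y s) = indicator (shell t \<rho>) y *\<^sub>R (f y + M) *\<^sub>R \<Omega> y" for y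
    unfolding h_def using fM[of y] by (subst integral_scaleR_left) (auto simp: integrable_indicator_iff)
  then have "(LINT y|lborel. LINT s|lborel. h y s) = (LINT y|lborel. indicator (shell t \<rho>) y *\<^sub>R f y *\<^sub>R \<Omega> y + M *\<^sub>R indicator (shell t \<rho>) y *\<^sub>R \<Omega> y)"
    by (simp add: scaleR_add_left scaleR_add_right mult.commute)
  also have "\<dots> = (LINT y|lborel. indicator (shell t \<rho>) y *\<^sub>R f y *\<^sub>R \<Omega> y)"
  proof -
    have i2: "integrable lborel (\<lambda>y. M *\<^sub>R indicator (shell t \<rho>) y *\<^sub>R \<Omega> y)"
      by (intro integrable_scaleR_right integrable_kernel[OF _ shell_subset]) auto
    have i1: "integrable lborel (\<lambda>y. indicator (shell t \<rho>) y *\<^sub>R f y *\<^sub>R \<Omega> y)"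
    proof (rule Bochner_Integration.integrable_bound[OF i2])
      show "AE y in lborel. norm (indicator (shell t \<rho>) y *\<^sub>R f y *\<^sub>R \<Omega> y) \<le> norm (M *\<^sub>R indicator (shell t \<rho>) y *\<^sub>R \<Omega> y)"
        using M by (auto intro!: AE_I2 mult_right_mono intro: order_trans[OF _ abs_ge_self] split: split_indicator)
    qed measurable
    show ?thesis
      by (simp only: Bochner_Integration.integral_add[OF i1 i2] integral_scaleR_right mean_shell) simp
  qed
  finally have "ennreal (norm (LINT y|lborel. indicator (shell t \<rho>) y *\<^sub>R f y *\<^sub>R \<Omega> y)) =
      ennreal (norm (LINT y|lborel. LINT s|lborel. h y s))" by simp
  also have "\<dots> \<le> (\<integral>\<^sup>+s. ennreal (norm (LINT y|lborel. h y s)) \<partial>lborel)"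
    by (rule lborel_pair.norm_iterated_integral_le[OF hint])
  also have "\<dots> \<le> (\<integral>\<^sup>+s. ennreal (K \<rho>) * (gagliardo \<alpha> (ball 0 \<rho>) (indicator (E s) :: 'a \<Rightarrow> real) * indicator {0..} s) \<partial>lborel)"
  proof (rule nn_integral_mono)
    fix s
    show "ennreal (norm (LINT y|lborel. h y s)) \<le> ennreal (K \<rho>) * (gagliardo \<alpha> (ball 0 \<rho>) (indicator (E s) :: 'a \<Rightarrow> real) * indicator {0..} s)"
    proof (cases "0 \<le> s")
      case True
      then have "(\<lambda>y. h y s) = (\<lambda>y. indicator (shell t \<rho> \<inter> E s) y *\<^sub>R \<Omega> y)"
        by (auto simp: h_def E_def shell_def fun_eq_iff split: split_indicator)
      moreover have "E s \<subseteq> ball 0 \<rho>" by (auto simp: E_def)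
      ultimately show ?thesis using True shell_integral_indicator_le[OF E _ \<rho>, of s t] by simp
    qed (simp add: h_def)
  qed
  also have "\<dots> = (\<integral>\<^sup>+s. ennreal (K \<rho>) * (gagliardo \<alpha> (ball 0 \<rho>) (indicator {y. s < f y + M} :: 'a \<Rightarrow> real) * indicator {0..} s) \<partial>lborel)"
  proof -
    have "gagliardo \<alpha> (ball 0 \<rho>) (indicator (E s) :: 'a \<Rightarrow> real) = gagliardo \<alpha> (ball 0 \<rho>) (indicator {y. s < f y + M} :: 'a \<Rightarrow> real)" for s
      unfolding gagliardo_def E_def by (intro nn_integral_cong) (auto split: split_indicator)
    then show ?thesis by simp
  qed
  also have "\<dots> = ennreal (K \<rho>) * (\<integral>\<^sup>+s. gagliardo \<alpha> (ball 0 \<rho>) (indicator {y. s < f y + M} :: 'a \<Rightarrow> real) * indicator {0..} s \<partial>lborel)"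
    using gagliardo_superlevel_measurable[of "\<lambda>y. f y + M" "ball 0 \<rho>" \<alpha>]
    by (intro nn_integral_cmult borel_measurable_times_ennreal) auto
  also have "\<dots> \<le> ennreal (K \<rho>) * (\<integral>\<^sup>+s. gagliardo \<alpha> (ball 0 \<rho>) (indicator {y. s < f y + M} :: 'a \<Rightarrow> real) \<partial>lborel)"
    by (intro mult_left_mono nn_integral_mono) (auto split: split_indicator)
  also have "\<dots> = ennreal (K \<rho>) * gagliardo \<alpha> (ball 0 \<rho>) (\<lambda>y. f y + M)"
    by (subst gagliardo_coarea) auto
  also have "gagliardo \<alpha> (ball 0 \<rho>) (\<lambda>y. f y + M) = gagliardo \<alpha> (ball 0 \<rho>) f"
    by (simp add: gagliardo_def)
  finally show ?thesis .
qed

lemma shell_integral_complex_le: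
  fixes f :: "'a \<Rightarrow> complex"
  assumes f[measurable]: "f \<in> borel_measurable borel" and M: "\<And>y. norm (f y) \<le> M" and \<rho>: "0 < \<rho>"
  shows "ennreal (norm (LINT y|lborel. indicator (shell t \<rho>) y *\<^sub>R (\<Omega> y * f y))) \<le>
    ennreal (2 * K \<rho>) * gagliardo \<alpha> (ball 0 \<rho>) f"
proof -
  have bnd: "\<bar>Re (f y)\<bar> \<le> M" "\<bar>Im (f y)\<bar> \<le> M" for y
    using M[of y] abs_Re_le_cmod[of "f y"] abs_Im_le_cmod[of "f y"] by auto
  have int: "integrable lborel (\<lambda>y. indicator (shell t \<rho>) y *\<^sub>R g y *\<^sub>R \<Omega> y)"
    if [measurable]: "g \<in> borel_measurable borel" and "\<And>y. \<bar>g y\<bar> \<le> M" for g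
  proof (rule Bochner_Integration.integrable_bound)
    show "integrable lborel (\<lambda>y. M *\<^sub>R indicator (shell t \<rho>) y *\<^sub>R \<Omega> y)"
      by (intro integrable_scaleR_right integrable_kernel[OF _ shell_subset]) auto
    show "AE y in lborel. norm (indicator (shell t \<rho>) y *\<^sub>R g y *\<^sub>R \<Omega> y) \<le> norm (M *\<^sub>R indicator (shell t \<rho>) y *\<^sub>R \<Omega> y)"
      using that by (auto intro!: AE_I2 mult_right_mono intro: order_trans[OF _ abs_ge_self] split: split_indicator)
  qed measurable
  have "(LINT y|lborel. indicator (shell t \<rho>) y *\<^sub>R (\<Omega> y * f y)) =
      (LINT y|lborel. indicator (shell t \<rho>) y *\<^sub>R Re (f y) *\<^sub>R \<Omega> y + \<i> * (indicator (shell t \<rho>) y *\<^sub>R Im (f y) *\<^sub>R \<Omega> y))"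
    by (intro Bochner_Integration.integral_cong) (auto simp: complex_eq_iff algebra_simps)
  also have "\<dots> = (LINT y|lborel. indicator (shell t \<rho>) y *\<^sub>R Re (f y) *\<^sub>R \<Omega> y) +
      \<i> * (LINT y|lborel. indicator (shell t \<rho>) y *\<^sub>R Im (f y) *\<^sub>R \<Omega> y)"
  proof -
    note i1 = int[of "\<lambda>y. Re (f y)"] and i2 = int[of "\<lambda>y. Im (f y)"]
    show ?thesis
      using bnd by (subst Bochner_Integration.integral_add[OF i1 integrable_mult_right[OF i2]])
        (auto simp only: integral_mult_right_zero, simp_all)
  qed
  finally have eq: "(LINT y|lborel. indicator (shell t \<rho>) y *\<^sub>R (\<Omega> y * f y)) =
      (LINT y|lborel. indicator (shell t \<rho>) y *\<^sub>R Re (f y) *\<^sub>R \<Omega> y) +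
      \<i> * (LINT y|lborel. indicator (shell t \<rho>) y *\<^sub>R Im (f y) *\<^sub>R \<Omega> y)" .
  have "ennreal (norm (LINT y|lborel. indicator (shell t \<rho>) y *\<^sub>R (\<Omega> y * f y))) \<le>
      ennreal (norm (LINT y|lborel. indicator (shell t \<rho>) y *\<^sub>R Re (f y) *\<^sub>R \<Omega> y) +
       norm (LINT y|lborel. indicator (shell t \<rho>) y *\<^sub>R Im (f y) *\<^sub>R \<Omega> y))"
    unfolding eq by (intro ennreal_leI order_trans[OF norm_triangle_ineq]) (simp add: norm_mult)
  also have "\<dots> \<le> ennreal (K \<rho>) * gagliardo \<alpha> (ball 0 \<rho>) (\<lambda>y. Re (f y)) + ennreal (K \<rho>) * gagliardo \<alpha> (ball 0 \<rho>) (\<lambda>y. Im (f y))"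
    unfolding ennreal_plus[OF norm_ge_zero norm_ge_zero]
    by (intro add_mono shell_integral_real_le) (use bnd \<rho> in auto)
  also have "\<dots> \<le> ennreal (K \<rho>) * gagliardo \<alpha> (ball 0 \<rho>) f + ennreal (K \<rho>) * gagliardo \<alpha> (ball 0 \<rho>) f"
    unfolding gagliardo_def
    by (intro add_mono mult_left_mono mult_right_mono nn_integral_mono ennreal_leI divide_right_mono)
       (use abs_Re_le_cmod[of "f _ - f _"] abs_Im_le_cmod[of "f _ - f _"] in auto)
  also have "\<dots> = ennreal (2 * K \<rho>) * gagliardo \<alpha> (ball 0 \<rho>) f"
    using K_nonneg by (subst ennreal_mult) (auto simp: mult_2[symmetric] mult.assoc)
  finally show ?thesis .
qed

end

section \<open>Truncated integrals of a Borel kernel\<close>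

lemma nonlinear_derivative_lborel:
  "nonlinear_derivative \<alpha> f x = (\<integral>\<^sup>+y. ennreal (norm (f x - f y) / norm (x - y) powr (real DIM('a) + \<alpha>)) \<partial>lborel)"
  for f :: "'a::euclidean_space \<Rightarrow> complex"
  by (simp add: nonlinear_derivative_def nn_integral_completion)

lemma nonlinear_derivative_measurable[measurable]:
  fixes f :: "'a::euclidean_space \<Rightarrow> complex"
  assumes [measurable]: "f \<in> borel_measurable borel"
  shows "nonlinear_derivative \<alpha> f \<in> borel_measurable borel"
  unfolding nonlinear_derivative_lborel[abs_def] by measurable

lemma gagliardo_le_nonlinear_derivative:
  fixes f :: "'a::euclidean_space \<Rightarrow> complex"
  assumes [measurable]: "f \<in> borel_measurable borel" "B \<in> sets borel"
  shows "gagliardo \<alpha> B f \<le> (\<integral>\<^sup>+y. nonlinear_derivative \<alpha> f y * indicator B y \<partial>lborel)"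
  unfolding gagliardo_def
proof (rule nn_integral_mono)
  fix x
  have "(\<integral>\<^sup>+y. ennreal (norm (f x - f y) / norm (x - y) powr (real DIM('a) + \<alpha>)) * indicator B x * indicator B y \<partial>lborel) \<le>
     (\<integral>\<^sup>+y. ennreal (norm (f x - f y) / norm (x - y) powr (real DIM('a) + \<alpha>)) * indicator B x \<partial>lborel)"
    by (intro nn_integral_mono) (auto split: split_indicator)
  also have "\<dots> = nonlinear_derivative \<alpha> f x * indicator B x"
    unfolding nonlinear_derivative_lborel by (intro nn_integral_multc) simp
  finally show "(\<integral>\<^sup>+y. ennreal (norm (f x - f y) / norm (x - y) powr (real DIM('a) + \<alpha>)) * indicator B x * indicator B y \<partial>lborel) \<le>
      nonlinear_derivative \<alpha> f x * indicator B x" .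
qed

context rough_kernel begin

text \<open>
  The formula \<open>|y|\<^sup>-\<^sup>n = n \<integral> \<rho>\<^sup>-\<^sup>n\<^sup>-\<^sup>1 d\<rho>\<close> turns the truncated integral into an average of integrals over
  shells. As \<open>f\<close> is bounded and vanishes far out, truncation at \<open>t\<close> makes everything absolutely integrable, so Fubini's theorem
  applies before the cancellation in the shells is used.
\<close>

lemma truncated_kernel_integral_le:
  fixes f :: "'a \<Rightarrow> complex"
  assumes f[measurable]: "f \<in> borel_measurable borel" and M: "\<And>y. norm (f y) \<le> M"
    and supp: "\<And>y. L \<le> norm y \<Longrightarrow> f y = 0" and t: "0 < t"
  shows "ennreal (norm (LINT y|lborel. indicator {y. t < norm y} y *\<^sub>R (\<Omega> y / of_real (norm y ^ DIM('a)) * f y))) \<le>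
    ennreal (8 * isoperimetric_const TYPE('a) * (1 - \<alpha>)) * ennreal N *
      (\<integral>\<^sup>+y. nonlinear_derivative \<alpha> f y / ennreal (norm y powr (real DIM('a) - \<alpha>)) \<partial>lborel)"
proof -
  define n where "n = DIM('a)"
  have n: "2 \<le> n" using dim by (simp add: n_def)
  \<comment> \<open>The condition \<open>norm y < \<rho>\<close> is written as an indicator of the difference to make joint measurability evident.\<close>
  define h where "h y \<rho> = (real n * \<rho> powr (- real n - 1) * indicator {0<..} (\<rho> - norm y) * indicator {t<..} (norm y)) *\<^sub>R (\<Omega> y * f y)"
    for y and \<rho> :: real
  define C where "C = 4 * N * (isoperimetric_const TYPE('a) * (1 - \<alpha>))"
  have C: "0 \<le> C" using N \<alpha> isoperimetric_const_pos[where 'a='a] by (simp add: C_def)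
  have M0: "0 \<le> M" using M[of 0] norm_ge_zero order_trans by blast
  have hm: "(\<lambda>(y, \<rho>). h y \<rho>) \<in> borel_measurable (lborel \<Otimes>\<^sub>M lborel)"
    unfolding h_def by measurable
  have radial: "has_bochner_integral lborel (\<lambda>\<rho>. real n * \<rho> powr (- real n - 1) * indicator {0<..} (\<rho> - s)) (s powr - real n)"
    if s: "0 < s" for s
  proof (rule has_bochner_integral_nn_integral)
    have "(\<integral>\<^sup>+\<rho>. ennreal (real n * \<rho> powr (- real n - 1) * indicator {0<..} (\<rho> - s)) \<partial>lborel) =
        (\<integral>\<^sup>+\<rho>. ennreal (real n) * (ennreal (\<rho> powr (- real n - 1)) * indicator {s<..} \<rho>) \<partial>lborel)"
      by (intro nn_integral_cong) (auto simp: ennreal_mult split: split_indicator)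
    also have "\<dots> = ennreal (real n) * ennreal (s powr - real n / real n)"
      using nn_integral_powr_greaterThan[of "real n" s] s n by (subst nn_integral_cmult) auto
    also have "\<dots> = ennreal (s powr - real n)" using n by (simp flip: ennreal_mult)
    finally show "(\<integral>\<^sup>+\<rho>. ennreal (real n * \<rho> powr (- real n - 1) * indicator {0<..} (\<rho> - s)) \<partial>lborel) = ennreal (s powr - real n)" .
  qed auto
  have "(\<integral>\<^sup>+y. \<integral>\<^sup>+\<rho>. ennreal (norm (h y \<rho>)) \<partial>lborel \<partial>lborel) \<le>
      (\<integral>\<^sup>+y. ennreal (t powr - real n * M) * (ennreal (norm (\<Omega> y)) * indicator (ball 0 L) y) \<partial>lborel)"
  proof (rule nn_integral_mono)
    fix y
    show "(\<integral>\<^sup>+\<rho>. ennreal (norm (h y \<rho>)) \<partial>lborel) \<le> ennreal (t powr - real n * M) * (ennreal (norm (\<Omega> y)) * indicator (ball 0 L) y)"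
    proof (cases "t < norm y \<and> norm y < L")
      case True
      have "(\<integral>\<^sup>+\<rho>. ennreal (norm (h y \<rho>)) \<partial>lborel) =
          (\<integral>\<^sup>+\<rho>. ennreal (real n * \<rho> powr (- real n - 1) * indicator {0<..} (\<rho> - norm y)) * ennreal (norm (\<Omega> y * f y)) \<partial>lborel)"
        using True by (intro nn_integral_cong) (auto simp: h_def simp flip: ennreal_mult split: split_indicator)
      also have "\<dots> = (\<integral>\<^sup>+\<rho>. ennreal (real n * \<rho> powr (- real n - 1) * indicator {0<..} (\<rho> - norm y)) \<partial>lborel) * ennreal (norm (\<Omega> y * f y))"
        by (intro nn_integral_multc) simp
      also have "(\<integral>\<^sup>+\<rho>. ennreal (real n * \<rho> powr (- real n - 1) * indicator {0<..} (\<rho> - norm y)) \<partial>lborel) = ennreal (norm y powr - real n)"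
        using radial[OF less_trans[OF t conjunct1[OF True]]]
        by (subst nn_integral_eq_integral) (auto simp: has_bochner_integral_iff)
      also have "ennreal (norm y powr - real n) * ennreal (norm (\<Omega> y * f y)) \<le> ennreal (t powr - real n * M * norm (\<Omega> y))"
      proof -
        have "norm y powr - real n \<le> t powr - real n"
          using True t by (intro powr_mono2') auto
        moreover have "norm (\<Omega> y * f y) \<le> M * norm (\<Omega> y)"
          using mult_left_mono[OF M[of y], of "norm (\<Omega> y)"] by (simp add: norm_mult mult.commute)
        ultimately have "norm y powr - real n * norm (\<Omega> y * f y) \<le> t powr - real n * (M * norm (\<Omega> y))"
          by (intro mult_mono) auto
        then show ?thesis by (simp flip: ennreal_mult add: mult.assoc ennreal_leI)
      qed
      also have "\<dots> = ennreal (t powr - real n * M) * (ennreal (norm (\<Omega> y)) * indicator (ball 0 L) y)"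
        using True M0 by (simp flip: ennreal_mult)
      finally show ?thesis .
    next
      case False
      then have "(\<lambda>\<rho>. h y \<rho>) = (\<lambda>_. 0)"
        using supp[of y] by (auto simp: h_def fun_eq_iff split: split_indicator)
      then show ?thesis by simp
    qed
  qed
  also have "\<dots> = ennreal (t powr - real n * M) * (\<integral>\<^sup>+y. ennreal (norm (\<Omega> y)) * indicator (ball 0 L) y \<partial>lborel)"
    by (intro nn_integral_cmult) simp
  also have "\<dots> < \<infinity>"
  proof -
    have "(\<integral>\<^sup>+y. ennreal (norm (\<Omega> y)) * indicator (ball 0 L) y \<partial>lborel) =
        (\<integral>\<^sup>+y. ennreal (norm (indicator (ball 0 L) y *\<^sub>R \<Omega> y)) \<partial>lborel)"
      by (intro nn_integral_cong) (auto split: split_indicator)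
    also have "\<dots> < \<infinity>"
      using integrable_kernel[of "ball 0 L" L] by (simp add: integrable_iff_bounded)
    finally show ?thesis by (simp add: ennreal_mult_less_top)
  qed
  finally have hint: "integrable (lborel \<Otimes>\<^sub>M lborel) (\<lambda>(y, \<rho>). h y \<rho>)"
    using hm by (intro integrableI_bounded) (simp_all add: lborel.nn_integral_fst[symmetric] split_beta')
  have inner: "(LINT \<rho>|lborel. h y \<rho>) = indicator {y. t < norm y} y *\<^sub>R (\<Omega> y / of_real (norm y ^ DIM('a)) * f y)" for y
  proof (cases "t < norm y")
    case True
    have s: "0 < norm y" by (rule less_trans[OF t True])
    have "(LINT \<rho>|lborel. h y \<rho>) = (LINT \<rho>|lborel. (real n * \<rho> powr (- real n - 1) * indicator {0<..} (\<rho> - norm y)) *\<^sub>R (\<Omega> y * f y))"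
      using True by (simp add: h_def)
    also have "\<dots> = (norm y powr - real n) *\<^sub>R (\<Omega> y * f y)"
      using radial[OF s] by (subst integral_scaleR_left) (auto simp: has_bochner_integral_iff)
    also have "norm y powr - real n = 1 / norm y ^ n"
      using s by (simp add: powr_minus powr_realpow divide_inverse)
    finally show ?thesis using True by (simp add: n_def scaleR_conv_of_real)
  qed (simp add: h_def)
  have "ennreal (norm (LINT y|lborel. indicator {y. t < norm y} y *\<^sub>R (\<Omega> y / of_real (norm y ^ DIM('a)) * f y))) =
      ennreal (norm (LINT y|lborel. LINT \<rho>|lborel. h y \<rho>))"
    by (simp add: inner)
  also have "\<dots> \<le> (\<integral>\<^sup>+\<rho>. ennreal (norm (LINT y|lborel. h y \<rho>)) \<partial>lborel)"
    by (rule lborel_pair.norm_iterated_integral_le[OF hint])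
  also have "\<dots> \<le> (\<integral>\<^sup>+\<rho>. \<integral>\<^sup>+y. ennreal (real n * C * \<rho> powr (- (real n - \<alpha>) - 1)) * (nonlinear_derivative \<alpha> f y * indicator {0<..} (\<rho> - norm y)) \<partial>lborel \<partial>lborel)"
  proof (rule nn_integral_mono)
    fix \<rho> :: real
    have h_shell: "(\<lambda>y. h y \<rho>) = (\<lambda>y. (real n * \<rho> powr (- real n - 1)) *\<^sub>R (indicator (shell t \<rho>) y *\<^sub>R (\<Omega> y * f y)))"
      by (auto simp: h_def shell_def fun_eq_iff split: split_indicator)
    show "ennreal (norm (LINT y|lborel. h y \<rho>)) \<le>
      (\<integral>\<^sup>+y. ennreal (real n * C * \<rho> powr (- (real n - \<alpha>) - 1)) * (nonlinear_derivative \<alpha> f y * indicator {0<..} (\<rho> - norm y)) \<partial>lborel)"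
    proof (cases "0 < \<rho>")
      case True
      have "ennreal (norm (LINT y|lborel. h y \<rho>)) =
          ennreal (real n * \<rho> powr (- real n - 1)) * ennreal (norm (LINT y|lborel. indicator (shell t \<rho>) y *\<^sub>R (\<Omega> y * f y)))"
        unfolding h_shell integral_scaleR_right by (simp flip: ennreal_mult)
      also have "\<dots> \<le> ennreal (real n * \<rho> powr (- real n - 1)) * (ennreal (2 * K \<rho>) *
          (\<integral>\<^sup>+y. nonlinear_derivative \<alpha> f y * indicator (ball 0 \<rho>) y \<partial>lborel))"
        by (intro mult_left_mono order_trans[OF shell_integral_complex_le[OF f M True]] gagliardo_le_nonlinear_derivative) auto
      also have "\<dots> = ennreal (real n * C * \<rho> powr (- (real n - \<alpha>) - 1)) * (\<integral>\<^sup>+y. nonlinear_derivative \<alpha> f y * indicator (ball 0 \<rho>) y \<partial>lborel)"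
      proof -
        have "\<rho> powr (- real n - 1) * \<rho> powr \<alpha> = \<rho> powr (- (real n - \<alpha>) - 1)"
          by (subst powr_add[symmetric]) (simp add: algebra_simps)
        then have eq: "real n * \<rho> powr (- real n - 1) * (2 * K \<rho>) = real n * C * \<rho> powr (- (real n - \<alpha>) - 1)"
          by (simp add: K_def C_def)
        show ?thesis
          unfolding eq[symmetric] using K_nonneg
          by (subst ennreal_mult[of "real n * \<rho> powr (- real n - 1)" "2 * K \<rho>"]) (auto simp only: mult.assoc, simp_all)
      qed
      also have "\<dots> = (\<integral>\<^sup>+y. ennreal (real n * C * \<rho> powr (- (real n - \<alpha>) - 1)) * (nonlinear_derivative \<alpha> f y * indicator (ball 0 \<rho>) y) \<partial>lborel)"
        by (intro nn_integral_cmult[symmetric]) simp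
      also have "\<dots> = (\<integral>\<^sup>+y. ennreal (real n * C * \<rho> powr (- (real n - \<alpha>) - 1)) * (nonlinear_derivative \<alpha> f y * indicator {0<..} (\<rho> - norm y)) \<partial>lborel)"
        by (intro nn_integral_cong) (auto split: split_indicator)
      finally show ?thesis .
    next
      case False
      then have "shell t \<rho> = {}" using t by (auto simp: shell_def)
      then show ?thesis unfolding h_shell by simp
    qed
  qed
  also have "\<dots> = (\<integral>\<^sup>+y. \<integral>\<^sup>+\<rho>. ennreal (real n * C * \<rho> powr (- (real n - \<alpha>) - 1)) * (nonlinear_derivative \<alpha> f y * indicator {0<..} (\<rho> - norm y)) \<partial>lborel \<partial>lborel)"
    by (rule lborel_pair.Fubini') measurable
  also have "\<dots> \<le> (\<integral>\<^sup>+y. ennreal (2 * C) * (nonlinear_derivative \<alpha> f y / ennreal (norm y powr (real n - \<alpha>))) \<partial>lborel)"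
  proof (intro nn_integral_mono_AE eventually_mono[OF AE_norm_neq[of 0]])
    fix y :: 'a
    assume "norm y \<noteq> 0"
    then have s: "0 < norm y" by simp
    let ?a = "real n - \<alpha>"
    have a: "0 < ?a" "real n \<le> 2 * ?a" using n \<alpha> by auto
    have "(\<integral>\<^sup>+\<rho>. ennreal (real n * C * \<rho> powr (- ?a - 1)) * (nonlinear_derivative \<alpha> f y * indicator {0<..} (\<rho> - norm y)) \<partial>lborel) =
        (\<integral>\<^sup>+\<rho>. (ennreal (real n * C) * nonlinear_derivative \<alpha> f y) * (ennreal (\<rho> powr (- ?a - 1)) * indicator {norm y<..} \<rho>) \<partial>lborel)"
      using C by (intro nn_integral_cong) (auto simp: ennreal_mult mult_ac split: split_indicator)
    also have "\<dots> = (ennreal (real n * C) * nonlinear_derivative \<alpha> f y) * ennreal (norm y powr - ?a / ?a)"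
      by (subst nn_integral_cmult) (use nn_integral_powr_greaterThan[OF a(1) s] in auto)
    also have "\<dots> = ennreal (real n * C * (norm y powr - ?a / ?a)) * nonlinear_derivative \<alpha> f y"
      using C a by (subst (2) ennreal_mult) (auto simp: mult_ac)
    also have "\<dots> \<le> ennreal (2 * C * norm y powr - ?a) * nonlinear_derivative \<alpha> f y"
    proof (intro mult_right_mono ennreal_leI)
      have "real n / ?a \<le> 2" using a by (simp add: field_simps)
      then have "real n / ?a * (C * norm y powr - ?a) \<le> 2 * (C * norm y powr - ?a)"
        using C by (intro mult_right_mono) auto
      then show "real n * C * (norm y powr - ?a / ?a) \<le> 2 * C * norm y powr - ?a"
        by (simp add: field_simps)
    qed simp
    also have "\<dots> = ennreal (2 * C) * (nonlinear_derivative \<alpha> f y / ennreal (norm y powr ?a))"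
      using C s by (simp add: divide_ennreal_def inverse_ennreal powr_minus[symmetric] ennreal_mult mult_ac)
    finally show "(\<integral>\<^sup>+\<rho>. ennreal (real n * C * \<rho> powr (- ?a - 1)) * (nonlinear_derivative \<alpha> f y * indicator {0<..} (\<rho> - norm y)) \<partial>lborel) \<le>
        ennreal (2 * C) * (nonlinear_derivative \<alpha> f y / ennreal (norm y powr ?a))" .
  qed
  also have "\<dots> = ennreal (2 * C) * (\<integral>\<^sup>+y. nonlinear_derivative \<alpha> f y / ennreal (norm y powr (real n - \<alpha>)) \<partial>lborel)"
    by (intro nn_integral_cmult) measurable
  also have "ennreal (2 * C) = ennreal (8 * isoperimetric_const TYPE('a) * (1 - \<alpha>)) * ennreal N"
    using N \<alpha> isoperimetric_const_pos[where 'a='a] by (simp add: C_def mult_ac flip: ennreal_mult)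
  finally show ?thesis by (simp add: n_def)
qed

end

section \<open>Borel representatives of kernels given on the sphere\<close>

lemma borel_measurable_lebesgue_AE:
  fixes f g :: "'a::euclidean_space \<Rightarrow> 'b::{second_countable_topology, real_normed_vector}"
  assumes g: "g \<in> borel_measurable borel" and AE: "AE x in lborel. f x = g x"
  shows "f \<in> borel_measurable lebesgue"
proof (rule measurableI)
  obtain Z where Z: "Z \<in> null_sets lborel" "{x. f x \<noteq> g x} \<subseteq> Z"
    using AE by (auto simp: eventually_ae_filter)
  fix A :: "'b set" assume A: "A \<in> sets borel"
  have "sym_diff (f -` A) (g -` A) \<subseteq> Z" using Z(2) by auto
  then have nul: "f -` A - g -` A \<in> null_sets lebesgue" "g -` A - f -` A \<in> null_sets lebesgue"
    using null_sets_completion_subset[OF _ null_sets_completionI[OF Z(1)]] by blast+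
  have "g -` A \<in> sets lebesgue"
    using measurable_sets[OF g A] by (auto intro: sets_completionI_sets)
  then have "(g -` A - (g -` A - f -` A)) \<union> (f -` A - g -` A) \<in> sets lebesgue"
    using nul by auto
  also have "(g -` A - (g -` A - f -` A)) \<union> (f -` A - g -` A) = f -` A" by auto
  finally show "f -` A \<inter> space lebesgue \<in> sets lebesgue" by simp
qed auto

text \<open>
  The surface measure sees the part of the cone in the unit ball; the whole cone is a countable union of dilates
  of this part.
\<close>

lemma null_cone:
  fixes A :: "'a::euclidean_space set"
  assumes A[measurable]: "A \<in> sets borel" "A \<subseteq> sphere 0 1" and null: "emeasure sphere_measure A = 0"
  shows "AE y in lborel. sgn y \<notin> A"
proof -
  have sgn_m[measurable]: "sgn \<in> borel_measurable (borel :: 'a measure)"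
    unfolding sgn_div_norm by measurable
  define U where "U \<rho> = {y \<in> ball 0 \<rho> - {0}. sgn y \<in> A}" for \<rho>
  have [measurable]: "U \<rho> \<in> sets borel" for \<rho>
    unfolding U_def by measurable
  have U1: "emeasure lborel (U 1) = 0"
    using null emeasure_sphere_measure[OF A] by (simp add: U_def)
  have "emeasure lborel (U (real k)) = 0" for k
  proof (cases "k = 0")
    case False
    have "emeasure lborel (U (real k)) = (\<integral>\<^sup>+y. indicator (U (real k)) y \<partial>lborel)" by simp
    also have "\<dots> = ennreal (real k ^ DIM('a)) * (\<integral>\<^sup>+y. indicator (U (real k)) (real k *\<^sub>R y) \<partial>lborel)"
      using nn_integral_lborel_affine[of "indicator (U (real k))" "real k" 0] False by simp
    also have "(\<lambda>y. indicator (U (real k)) (real k *\<^sub>R y) :: ennreal) = indicator (U 1)"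
      using False by (auto simp: U_def fun_eq_iff sgn_scaleR split: split_indicator)
    also have "(\<integral>\<^sup>+y. indicator (U 1) y \<partial>lborel) = 0" using U1 by simp
    finally show ?thesis by simp
  qed (simp add: U_def)
  then have "(\<Union>k. U (real k)) \<in> null_sets lborel"
    by (intro null_sets_UN) (auto simp: null_sets_def)
  moreover have "{y \<in> space lborel. \<not> sgn y \<notin> A} \<subseteq> (\<Union>k. U (real k))"
  proof
    fix y assume "y \<in> {y \<in> space lborel. \<not> sgn y \<notin> A}"
    then have y: "sgn y \<in> A" by simp
    then have "y \<noteq> 0" using A(2) by auto
    moreover obtain k :: nat where "norm y < real k" using reals_Archimedean2 by blast
    ultimately show "y \<in> (\<Union>k. U (real k))" using y by (auto simp: U_def)
  qed
  ultimately show ?thesis by (rule AE_I')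
qed

lemma scale_measure_eq_density: "scale_measure r M = density M (\<lambda>_. r)"
  by (rule measure_eqI) (auto simp: emeasure_density_const)

lemma sgn_measurable_sphere:
  "sgn \<in> measurable (restrict_space lborel (ball 0 1 - {0})) (restrict_space borel (sphere (0::'a::euclidean_space) 1))"
proof (rule measurable_restrict_space2)
  show "sgn \<in> space (restrict_space lborel (ball 0 1 - {0})) \<rightarrow> sphere (0::'a) 1"
    by (auto simp: space_restrict_space norm_sgn)
  have "sgn \<in> borel_measurable (borel :: 'a measure)"
    unfolding sgn_div_norm by measurable
  then show "sgn \<in> borel_measurable (restrict_space lborel (ball (0::'a) 1 - {0}))"
    by (intro measurable_restrict_space1) simp
qed

lemma integral_sphere_measure:
  fixes g :: "'a::euclidean_space \<Rightarrow> complex"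
  assumes g[measurable]: "g \<in> borel_measurable borel" and g0: "g 0 = 0"
  shows "(LINT \<theta>|sphere_measure. g \<theta>) = DIM('a) *\<^sub>R (LINT y|lborel. indicator (ball 0 1) y *\<^sub>R g (sgn y))"
proof -
  let ?R = "restrict_space lborel (ball (0::'a) 1 - {0})"
  let ?S = "restrict_space borel (sphere (0::'a) 1)"
  have gS: "g \<in> borel_measurable ?S" by (intro measurable_restrict_space1) simp
  have "(LINT \<theta>|sphere_measure. g \<theta>) = (LINT \<theta>|density (distr ?R ?S sgn) (\<lambda>_. ennreal (real DIM('a))). g \<theta>)"
    unfolding sphere_measure_def scale_measure_eq_density ennreal_of_nat_eq_real_of_nat
    using gS by (intro integral_completion) simp
  also have "\<dots> = DIM('a) *\<^sub>R (LINT \<theta>|distr ?R ?S sgn. g \<theta>)"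
    using gS by (subst integral_density) auto
  also have "(LINT \<theta>|distr ?R ?S sgn. g \<theta>) = (LINT y|?R. g (sgn y))"
    using gS sgn_measurable_sphere by (intro integral_distr)
  also have "\<dots> = (LINT y|lborel. indicator (ball 0 1 - {0}) y *\<^sub>R g (sgn y))"
    by (intro integral_restrict_space) simp
  also have "\<dots> = (LINT y|lborel. indicator (ball 0 1) y *\<^sub>R g (sgn y))"
    by (intro Bochner_Integration.integral_cong) (auto simp: g0 split: split_indicator)
  finally show ?thesis .
qed

lemma finite_sphere_measure: "emeasure (sphere_measure :: 'a::euclidean_space measure) A < \<infinity>"
proof -
  have "emeasure sphere_measure A \<le> emeasure sphere_measure (sphere (0::'a) 1)"
    using emeasure_space[of sphere_measure A] by simp
  also have "\<dots> = of_nat DIM('a) * emeasure lborel {y \<in> ball 0 1 - {0}. sgn y \<in> sphere (0::'a) 1}"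
    by (intro emeasure_sphere_measure) auto
  also have "\<dots> \<le> of_nat DIM('a) * emeasure lborel (ball (0::'a) 1)"
    by (intro mult_left_mono emeasure_mono) auto
  also have "\<dots> < \<infinity>"
    using emeasure_lborel_ball_finite[of "0::'a" 1] by (simp add: ennreal_mult_less_top of_nat_less_top)
  finally show ?thesis .
qed

text \<open>
  \<open>\<Omega>\<close> is measurable only with respect to the completed surface measure. It agrees almost everywhere on the sphere with a
  Borel function \<open>G\<close>, and \<open>G \<circ> sgn\<close> is a homogeneous Borel function that agrees with \<open>\<Omega>\<close> almost everywhere in space.
\<close>

lemma rough_kernel_representative:
  fixes \<Omega> :: "'a::euclidean_space \<Rightarrow> complex"
  assumes \<alpha>: "0 < \<alpha>" "\<alpha> < 1" and dim: "2 \<le> DIM('a)"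
    and hom: "homogeneous_degree_zero \<Omega>" and mean: "zero_average \<Omega>"
    and weak: "\<Omega> \<in> weak_Lp (DIM('a) / \<alpha>)"
  obtains \<Omega>' where "rough_kernel \<Omega>' (enn2real (weak_Lp_norm (DIM('a) / \<alpha>) \<Omega>)) \<alpha>"
    and "AE y in lborel. \<Omega> y = \<Omega>' y"
proof -
  let ?p = "DIM('a) / \<alpha>"
  let ?\<sigma> = "sphere_measure :: 'a measure"
  let ?S = "restrict_space borel (sphere (0::'a) 1)"
  define N where "N = enn2real (weak_Lp_norm ?p \<Omega>)"
  have NN: "weak_Lp_norm ?p \<Omega> = ennreal N" using weak ennreal_enn2real by (simp add: weak_Lp_def N_def)
  have N0: "0 \<le> N" by (simp add: N_def)
  have \<Omega>m[measurable]: "\<Omega> \<in> borel_measurable ?\<sigma>" using weak by (simp add: weak_Lp_def)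
  define S0 where "S0 = scale_measure (of_nat DIM('a)) (distr (restrict_space lborel (ball (0::'a) 1 - {0})) ?S sgn)"
  have \<sigma>: "?\<sigma> = completion S0" by (simp add: sphere_measure_def S0_def)
  have S0: "sets S0 = sets ?S" "space S0 = sphere 0 1" by (simp_all add: S0_def space_scale_measure space_restrict_space)
  have "(\<lambda>x. Re (\<Omega> x)) \<in> borel_measurable (completion S0)" "(\<lambda>x. Im (\<Omega> x)) \<in> borel_measurable (completion S0)"
    unfolding \<sigma>[symmetric] by measurable
  then obtain g1 g2 where g: "g1 \<in> borel_measurable S0" "AE x in S0. Re (\<Omega> x) = g1 x"
      "g2 \<in> borel_measurable S0" "AE x in S0. Im (\<Omega> x) = g2 x"
    using completion_ex_borel_measurable_real by metis
  define G where "G x = indicator (sphere 0 1) x *\<^sub>R Complex (g1 x) (g2 x)" for x :: 'a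
  have "(\<lambda>x. indicator (sphere 0 1) x *\<^sub>R g1 x) \<in> borel_measurable borel" "(\<lambda>x. indicator (sphere 0 1) x *\<^sub>R g2 x) \<in> borel_measurable borel"
    using g(1,3) by (auto simp: measurable_cong_sets[OF S0(1) refl] borel_measurable_restrict_space_iff)
  then have Gm[measurable]: "G \<in> borel_measurable borel"
    unfolding G_def by (simp add: borel_measurable_complex_iff mult.commute)
  have "AE x in S0. \<Omega> x = G x"
    using g(2,4) AE_space[of S0] by eventually_elim (auto simp: G_def S0 complex_eq_iff)
  then obtain Z where Z: "Z \<in> null_sets S0" "{x \<in> space S0. \<Omega> x \<noteq> G x} \<subseteq> Z"
    by (auto simp: eventually_ae_filter)
  have Z_sets: "Z \<in> sets borel" "Z \<subseteq> sphere 0 1"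
    using Z(1) by (auto simp: null_sets_def S0 sets_restrict_space)
  have Z0: "emeasure ?\<sigma> Z = 0"
    using null_sets_completionI[OF Z(1)] by (simp add: \<sigma> null_sets_def)
  define \<Omega>' where "\<Omega>' y = G (sgn y)" for y
  have sgn_m[measurable]: "sgn \<in> borel_measurable (borel :: 'a measure)"
    unfolding sgn_div_norm by measurable
  have AE\<sigma>: "AE x in ?\<sigma>. \<Omega> x = G x"
    unfolding \<sigma> by (rule AE_completion) fact
  have G\<sigma>[measurable]: "G \<in> borel_measurable ?\<sigma>"
    unfolding \<sigma> by (intro measurable_completion) (simp add: measurable_cong_sets[OF S0(1) refl] measurable_restrict_space1)
  have mean': "(LINT y|lborel. indicator (ball 0 1) y *\<^sub>R \<Omega>' y) = 0"
  proof -
    have "(LINT \<theta>|?\<sigma>. G \<theta>) = (LINT \<theta>|?\<sigma>. \<Omega> \<theta>)"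
      using AE\<sigma> by (intro integral_cong_AE) auto
    then show ?thesis
      using mean integral_sphere_measure[OF Gm] by (simp add: zero_average_def \<Omega>'_def G_def)
  qed
  have weak': "emeasure lborel {y \<in> ball 0 1. t < norm (\<Omega>' y)} \<le> ennreal ((N / t) powr ?p)" if t: "0 < t" for t
  proof -
    let ?m = "measure ?\<sigma> {\<theta> \<in> sphere 0 1. t < norm (\<Omega> \<theta>)}"
    have "ennreal (t * ?m powr (1 / ?p)) \<le> weak_Lp_norm ?p \<Omega>"
      unfolding weak_Lp_norm_def using t by (intro SUP_upper) auto
    then have "t * ?m powr (1 / ?p) \<le> N" using N0 by (simp add: NN)
    then have "?m powr (1 / ?p) \<le> N / t" using t by (simp add: field_simps)
    then have "(?m powr (1 / ?p)) powr ?p \<le> (N / t) powr ?p"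
      using \<alpha> by (intro powr_mono2) auto
    then have m: "?m \<le> (N / t) powr ?p" using \<alpha> by (simp add: powr_powr)
    have "emeasure lborel {y \<in> ball 0 1. t < norm (\<Omega>' y)} =
        emeasure lborel {y \<in> ball 0 1 - {0}. sgn y \<in> {\<theta> \<in> sphere 0 1. t < norm (G \<theta>)}}"
      using t by (intro arg_cong[where f = "emeasure lborel"]) (auto simp: \<Omega>'_def G_def norm_sgn split: split_indicator)
    \<comment> \<open>Dropping the factor \<open>1 / n\<close> between the two measures costs only a constant.\<close>
    also have "\<dots> \<le> of_nat DIM('a) * \<dots>"
      using dim mult_right_mono[of "1::ennreal" "of_nat DIM('a)"] by simp
    also have "\<dots> = emeasure ?\<sigma> {\<theta> \<in> sphere 0 1. t < norm (G \<theta>)}"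
      by (intro emeasure_sphere_measure[symmetric]) auto
    also have "\<dots> = emeasure ?\<sigma> {\<theta> \<in> sphere 0 1. t < norm (\<Omega> \<theta>)}"
    proof (rule emeasure_eq_AE)
      have "{\<theta> \<in> space ?\<sigma>. t < norm (G \<theta>)} \<in> sets ?\<sigma>" "{\<theta> \<in> space ?\<sigma>. t < norm (\<Omega> \<theta>)} \<in> sets ?\<sigma>"
        by measurable
      then show  "{\<theta> \<in> sphere 0 1. t < norm (G \<theta>)} \<in> sets ?\<sigma>" "{\<theta> \<in> sphere 0 1. t < norm (\<Omega> \<theta>)} \<in> sets ?\<sigma>"
        unfolding space_sphere_measure .
      show "AE \<theta> in ?\<sigma>. \<theta> \<in> {\<theta> \<in> sphere 0 1. t < norm (G \<theta>)} \<longleftrightarrow> \<theta> \<in> {\<theta> \<in> sphere 0 1. t < norm (\<Omega> \<theta>)}"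
        by (rule eventually_mono[OF AE\<sigma>]) simp
    qed
    also have "\<dots> = ennreal ?m"
      using less_imp_neq[OF finite_sphere_measure[of "{\<theta> \<in> sphere (0::'a) 1. t < norm (\<Omega> \<theta>)}"]]
      unfolding infinity_ennreal_def by (rule emeasure_eq_ennreal_measure)
    also have "\<dots> \<le> ennreal ((N / t) powr ?p)" using m by (rule ennreal_leI)
    finally show ?thesis .
  qed
  have "rough_kernel \<Omega>' N \<alpha>"
  proof
    show "\<Omega>' (r *\<^sub>R y) = \<Omega>' y" if "0 < r" for r y
      using that by (simp add: \<Omega>'_def sgn_scaleR)
    show "\<Omega>' \<in> borel_measurable borel" unfolding \<Omega>'_def by measurable
  qed (use mean' weak' \<alpha> dim in \<open>auto simp: N_def\<close>)
  moreover have "AE y in lborel. \<Omega> y = \<Omega>' y"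
    using null_cone[OF Z_sets Z0] AE_norm_neq[of 0]
  proof eventually_elim
    case (elim y)
    then have "\<Omega> y = \<Omega> (sgn y)"
      using hom unfolding homogeneous_degree_zero_def sgn_div_norm by simp
    moreover have "sgn y \<in> space S0"
      using elim by (simp add: S0 norm_sgn)
    then have "\<Omega> (sgn y) = G (sgn y)"
      using Z(2) elim by blast
    ultimately show ?case by (simp add: \<Omega>'_def)
  qed
  ultimately show ?thesis using that by (simp add: N_def)
qed

section \<open>The pointwise bound\<close>

lemma Cc_infinity_bounded_support:
  fixes f :: "'a::euclidean_space \<Rightarrow> 'b::euclidean_space"
  assumes "f \<in> Cc_infinity"
  obtains M L where "continuous_on UNIV f" "\<And>y. norm (f y) \<le> M" "\<And>y. L \<le> norm y \<Longrightarrow> f y = 0"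
proof -
  let ?S = "closure {x. f x \<noteq> 0}"
  have "Ck 0 f" using assms by (auto simp: Cc_infinity_def)
  then have cont: "continuous_on UNIV f" by simp
  have comp: "compact ?S" using assms by (simp add: Cc_infinity_def)
  obtain L where L: "\<And>x. x \<in> ?S \<Longrightarrow> norm x < L"
    using compact_imp_bounded[OF comp] by (metis bounded_pos_less)
  have "compact (f ` ?S)" using comp cont by (intro compact_continuous_image) (auto intro: continuous_on_subset)
  then obtain M where M: "\<And>x. x \<in> ?S \<Longrightarrow> norm (f x) < M" "0 < M"
    using compact_imp_bounded bounded_pos_less by (metis imageI)
  have out: "f x = 0" if "x \<notin> ?S" for x using that closure_subset[of "{x. f x \<noteq> 0}"] by auto
  show thesis
  proof (rule that[OF cont])
    show "norm (f y) \<le> M" for y using M out[of y] by (cases "y \<in> ?S") (auto intro: less_imp_le)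
    show "f y = 0" if "L \<le> norm y" for y using L[of y] out[of y] that by (cases "y \<in> ?S") auto
  qed
qed

lemma nonlinear_derivative_reflect:
  fixes f :: "'a::euclidean_space \<Rightarrow> complex"
  assumes [measurable]: "f \<in> borel_measurable borel"
  shows "nonlinear_derivative \<alpha> (\<lambda>y. f (x - y)) y = nonlinear_derivative \<alpha> f (x - y)"
proof -
  have "nonlinear_derivative \<alpha> f (x - y) =
      (\<integral>\<^sup>+z. ennreal (norm (f (x - y) - f (x - z)) / norm (x - y - (x - z)) powr (real DIM('a) + \<alpha>)) \<partial>lborel)"
    unfolding nonlinear_derivative_lborel
    by (subst nn_integral_lborel_affine[where c = "-1" and t = x]) auto
  also have "\<dots> = nonlinear_derivative \<alpha> (\<lambda>y. f (x - y)) y"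
    unfolding nonlinear_derivative_lborel by (simp add: norm_minus_commute)
  finally show ?thesis by simp
qed

lemma riesz_potential_reflect:
  fixes g :: "'a::euclidean_space \<Rightarrow> ennreal"
  assumes [measurable]: "g \<in> borel_measurable borel"
  shows "riesz_potential \<alpha> g x = (\<integral>\<^sup>+y. g (x - y) / ennreal (norm y powr (real DIM('a) - \<alpha>)) \<partial>lborel)"
  unfolding riesz_potential_def nn_integral_completion
  by (subst nn_integral_lborel_affine[where c = "-1" and t = x]) auto

text \<open>
  Replacing \<open>\<Omega>\<close> by its Borel representative does not change the truncated integrals. Applied to
  \<open>\<lambda>y. f (x - y)\<close>, the estimate for truncated integrals gives the Riesz potential at \<open>x\<close>, since the nonlinear
  derivative commutes with this reflection.
\<close>

theorem maximal_truncated_le: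
  fixes \<Omega> :: "'a::euclidean_space \<Rightarrow> complex"
  assumes \<alpha>: "0 < \<alpha>" "\<alpha> < 1" and dim: "2 \<le> DIM('a)"
    and hom: "homogeneous_degree_zero \<Omega>" and mean: "zero_average \<Omega>"
    and weak: "\<Omega> \<in> weak_Lp (DIM('a) / \<alpha>)" and f: "f \<in> Cc_infinity"
  shows "maximal_truncated \<Omega> f x \<le> ennreal (8 * isoperimetric_const TYPE('a) * (1 - \<alpha>)) * weak_Lp_norm (DIM('a) / \<alpha>) \<Omega> *
    riesz_potential \<alpha> (nonlinear_derivative \<alpha> f) x"
proof -
  obtain \<Omega>' where K: "rough_kernel \<Omega>' (enn2real (weak_Lp_norm (DIM('a) / \<alpha>) \<Omega>)) \<alpha>"
    and AE: "AE y in lborel. \<Omega> y = \<Omega>' y"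
    using rough_kernel_representative[OF \<alpha> dim hom mean weak] by blast
  interpret rough_kernel \<Omega>' "enn2real (weak_Lp_norm (DIM('a) / \<alpha>) \<Omega>)" \<alpha> by (rule K)
  obtain M L where cont: "continuous_on UNIV f" and M: "\<And>y. norm (f y) \<le> M" and L: "\<And>y. L \<le> norm y \<Longrightarrow> f y = 0"
    using Cc_infinity_bounded_support[OF f] by blast
  have fm[measurable]: "f \<in> borel_measurable borel" using cont by (rule borel_measurable_continuous_onI)
  have N: "ennreal (enn2real (weak_Lp_norm (DIM('a) / \<alpha>) \<Omega>)) = weak_Lp_norm (DIM('a) / \<alpha>) \<Omega>"
    using weak ennreal_enn2real by (simp add: weak_Lp_def)
  show ?thesis
    unfolding maximal_truncated_def
  proof (rule SUP_least)
    fix t :: real assume "t \<in> {0<..}"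
    then have t: "0 < t" by simp
    let ?h = "\<lambda>\<Omega> y. indicator {y. t < norm y} y *\<^sub>R (\<Omega> y / of_real (norm y ^ DIM('a)) * f (x - y))"
    have hm: "?h \<Omega>' \<in> borel_measurable borel" by measurable
    have AEh: "AE y in lborel. ?h \<Omega> y = ?h \<Omega>' y" using AE by eventually_elim simp
    have "truncated_integral \<Omega> f t x = (LINT y|lebesgue. ?h \<Omega> y)"
      by (simp add: truncated_integral_def set_lebesgue_integral_def)
    also have "\<dots> = (LINT y|lebesgue. ?h \<Omega>' y)"
      using AEh hm by (intro integral_cong_AE AE_completion borel_measurable_lebesgue_AE[OF hm AEh]) (auto intro: measurable_completion)
    also have "\<dots> = (LINT y|lborel. ?h \<Omega>' y)"
      using hm by (intro integral_completion) simp
    finally have "ennreal (norm (truncated_integral \<Omega> f t x)) = ennreal (norm (LINT y|lborel. ?h \<Omega>' y))" by simp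
    also have "\<dots> \<le> ennreal (8 * isoperimetric_const TYPE('a) * (1 - \<alpha>)) * ennreal (enn2real (weak_Lp_norm (DIM('a) / \<alpha>) \<Omega>)) *
      (\<integral>\<^sup>+y. nonlinear_derivative \<alpha> (\<lambda>y. f (x - y)) y / ennreal (norm y powr (real DIM('a) - \<alpha>)) \<partial>lborel)"
    proof (rule truncated_kernel_integral_le[OF _ _ _ t])
      show "f (x - y) = 0" if "L + norm x \<le> norm y" for y
        using that norm_triangle_ineq2[of y x] by (intro L) (simp add: norm_minus_commute)
    qed (use M in auto)
    also have "\<dots> = ennreal (8 * isoperimetric_const TYPE('a) * (1 - \<alpha>)) * weak_Lp_norm (DIM('a) / \<alpha>) \<Omega> *
      riesz_potential \<alpha> (nonlinear_derivative \<alpha> f) x"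
      unfolding N by (simp add: nonlinear_derivative_reflect riesz_potential_reflect)
    finally show "ennreal (norm (truncated_integral \<Omega> f t x)) \<le> ennreal (8 * isoperimetric_const TYPE('a) * (1 - \<alpha>)) * weak_Lp_norm (DIM('a) / \<alpha>) \<Omega> *
      riesz_potential \<alpha> (nonlinear_derivative \<alpha> f) x" .
  qed
qed

theorem theorem2p5:
  assumes "CARD('n::finite) \<ge> 2"
  shows "\<exists>c::real. 0 < c \<and>
    (\<forall>(\<alpha>::real) (\<Omega> :: real ^ 'n \<Rightarrow> complex).
       0 < \<alpha> \<and> \<alpha> < 1 \<and> homogeneous_degree_zero \<Omega> \<and> zero_average \<Omega> \<and>
       \<Omega> \<in> weak_Lp (real CARD('n) / \<alpha>) \<longrightarrow>
       (\<forall>f\<in>Cc_infinity. \<forall>x.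
          maximal_truncated \<Omega> f x
            \<le> ennreal (c * (1 - \<alpha>)) * weak_Lp_norm (real CARD('n) / \<alpha>) \<Omega>
               * riesz_potential \<alpha> (nonlinear_derivative \<alpha> f) x))"
proof (intro exI[of _ "8 * isoperimetric_const TYPE(real ^ 'n)"] conjI allI impI ballI)
  show "0 < 8 * isoperimetric_const TYPE(real ^ 'n)" using isoperimetric_const_pos by simp
next
  fix \<alpha> :: real and \<Omega> :: "real ^ 'n \<Rightarrow> complex" and f :: "real ^ 'n \<Rightarrow> complex" and x
  assume "0 < \<alpha> \<and> \<alpha> < 1 \<and> homogeneous_degree_zero \<Omega> \<and> zero_average \<Omega> \<and> \<Omega> \<in> weak_Lp (real CARD('n) / \<alpha>)"
    and "f \<in> Cc_infinity"
  then show "maximal_truncated \<Omega> f x \<le> ennreal (8 * isoperimetric_const TYPE(real ^ 'n) * (1 - \<alpha>)) *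
      weak_Lp_norm (real CARD('n) / \<alpha>) \<Omega> * riesz_potential \<alpha> (nonlinear_derivative \<alpha> f) x"
    using maximal_truncated_le[of \<alpha> \<Omega> f x] assms by simp
qed

end
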